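(* Let $p$ be a prime, let $L$ be a field of characteristic $p$ with a fixed algebraic closure $\overline{L}$, and let $\overline{\mathbb{F}}_p$ denote the algebraic closure of $\mathbb{F}_p$ inside $\overline{L}$. Let $f(x)=c_1x^{d_1}+c_2x^{d_2}\in\overline{\mathbb{F}}_p[x]$ with $c_1,c_2\in\overline{\mathbb{F}}_p^*$, $1\le d_1<d_2$, and write $d_i=p^{\ell_i}s_i$ with integers $\ell_i\ge0$ and $p\nmid s_i$. Assume $s_2>1$ and $$p^{\ell_2}(s_2-1)<p^{\ell_1}(s_1-1).$$ Let $\alpha_1,\alpha_2,\beta\in L$, and assume that not all of $\alpha_1,\alpha_2,\beta$ lie in $\overline{\mathbb{F}}_p$. Then $C_f(\alpha_1,\alpha_2;\beta)$ is infinite if and only if $f(\alpha_1)=f(\alpha_2)$.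
   Context: For $\lambda\in\overline{L}$ let $f_\lambda(x):=f(x)+\lambda$, and $f_\lambda^m$ its $m$-th iterate. $C_f(\alpha_1,\alpha_2;\beta)$ is the set of $\lambda\in\overline{L}$ for which there exist positive integers $m,n$ with $f_\lambda^m(\alpha_1)=f_\lambda^n(\alpha_2)=\beta$. *)

theory Defs
  imports "HOL-Computational_Algebra.Computational_Algebra"
begin

definition is_subfield :: "'k::field set \<Rightarrow> bool" where
  "is_subfield K \<longleftrightarrow>
     0 \<in> K \<and> 1 \<in> K \<and>
     (\<forall>x\<in>K. \<forall>y\<in>K. x + y \<in> K \<and> x * y \<in> K) \<and>
     (\<forall>x\<in>K. - x \<in> K \<and> inverse x \<in> K)"

definition algebraic_over :: "'k::field set \<Rightarrow> 'k \<Rightarrow> bool" where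
  "algebraic_over K x \<longleftrightarrow> (\<exists>q. q \<noteq> 0 \<and> (\<forall>i. coeff q i \<in> K) \<and> poly q x = 0)"

text \<open>The whole type is an algebraic closure of its subset \<open>L\<close>; algebraic closedness itself
  is supplied by the type class.\<close>

definition algebraic_closure_of :: "'k::alg_closed_field set \<Rightarrow> bool" where
  "algebraic_closure_of L \<longleftrightarrow> is_subfield L \<and> (\<forall>x. algebraic_over L x)"

text \<open>The algebraic closure of the prime field inside \<open>'k\<close>. In positive characteristic the
  multiples of \<open>1\<close> form the prime field; in characteristic 0 they would only form
  the ring of integers.\<close>

definition Fp_bar :: "'k::alg_closed_field set" where
  "Fp_bar = {x. algebraic_over (range of_int) x}"

definition shifted :: "'k::field poly \<Rightarrow> 'k \<Rightarrow> 'k \<Rightarrow> 'k" where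
  "shifted f \<mu> x = poly f x + \<mu>"

definition C_set :: "'k::field poly \<Rightarrow> 'k \<Rightarrow> 'k \<Rightarrow> 'k \<Rightarrow> 'k set" where
  "C_set f \<alpha>1 \<alpha>2 \<beta> =
     {\<mu>. \<exists>m n. 0 < m \<and> 0 < n \<and>
         (shifted f \<mu> ^^ m) \<alpha>1 = \<beta> \<and> (shifted f \<mu> ^^ n) \<alpha>2 = \<beta>}"

end

theory Submission
  imports Defs
begin

text \<open>Write \<open>x\<^sub>k(\<mu>)\<close>, \<open>y\<^sub>k(\<mu>)\<close> for the \<open>k\<close>-th iterates of \<open>\<alpha>1\<close>, \<open>\<alpha>2\<close> under \<open>f + \<mu>\<close>, as polynomials
  in \<open>\<mu>\<close>, and \<open>C = f(\<alpha>1) - f(\<alpha>2)\<close>. Their leading coefficients are units at every valuation, while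
  \<open>x\<^sub>k - y\<^sub>k\<close> has leading coefficient \<open>C\<^sup>g\<close> up to such a unit, with \<open>g\<close> unbounded in \<open>k\<close>. If \<open>\<mu>\<close> is a late
  collision parameter then at every valuation \<open>x\<^sub>k(\<mu>)\<close> and \<open>y\<^sub>k(\<mu>)\<close> are bounded by the largest of
  \<open>1, \<alpha>1, \<alpha>2, \<beta>\<close>.

  Suppose that there are infinitely many collisions and that \<open>C\<close> is transcendental over \<open>\<F>\<^sub>p\<close>. Choose a
  field of constants over which everything is algebraic over \<open>C\<close>. The discriminant of a large
  set of late collision parameters is estimated at all places by a Vandermonde determinant built from
  powers of some \<open>x\<^sub>K\<close>, and at the poles of \<open>C\<close>, much better, by one built from powers of some
  \<open>x\<^sub>k - y\<^sub>k\<close>. Together the estimates produce a nonzero element that is integral at every place and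
  vanishes at some place, which is absurd. This replaces the equidistribution of small points.
  So \<open>C\<close> is a constant, and if it is not zero then comparing \<open>x\<^sub>k\<close> and \<open>y\<^sub>k\<close> at a pole of
  \<open>\<alpha>1\<close>, \<open>\<alpha>2\<close> or \<open>\<beta>\<close> gives a contradiction.

  Conversely, if \<open>C = 0\<close> then the number of distinct roots of \<open>x\<^sub>k - \<beta>\<close> is unbounded, since the
  derivative of \<open>x\<^sub>k\<close> is a nonzero polynomial of much smaller degree.\<close>

section \<open>Valuation rings\<close>

locale unital_subring =
  fixes A :: "'k::field set"
  assumes one_closed: "1 \<in> A"
    and diff_closed: "x \<in> A \<Longrightarrow> y \<in> A \<Longrightarrow> x - y \<in> A"
    and mult_closed: "x \<in> A \<Longrightarrow> y \<in> A \<Longrightarrow> x * y \<in> A"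
begin

lemma zero_closed: "0 \<in> A"
  using diff_closed[OF one_closed one_closed] by simp

lemma uminus_closed: "x \<in> A \<Longrightarrow> - x \<in> A"
  using diff_closed[OF zero_closed] by force

lemma add_closed: "x \<in> A \<Longrightarrow> y \<in> A \<Longrightarrow> x + y \<in> A"
  using diff_closed[of x "- y"] uminus_closed[of y] by simp

lemma power_closed: "x \<in> A \<Longrightarrow> x ^ n \<in> A"
  by (induction n) (auto intro: one_closed mult_closed)

lemma sum_closed: "(\<And>i. i \<in> I \<Longrightarrow> g i \<in> A) \<Longrightarrow> sum g I \<in> A"
  by (induction I rule: infinite_finite_induct) (auto intro: zero_closed add_closed)

lemma of_nat_closed: "of_nat n \<in> A"
  by (induction n) (auto intro: zero_closed one_closed add_closed)

lemma of_int_closed: "of_int i \<in> A"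
  by (cases i) (auto intro!: of_nat_closed uminus_closed diff_closed one_closed)

lemma poly_closed: "(\<And>i. coeff q i \<in> A) \<Longrightarrow> x \<in> A \<Longrightarrow> poly q x \<in> A"
  unfolding poly_altdef by (intro sum_closed mult_closed power_closed) auto

lemma coeff_add_closed: "(\<And>i. coeff q i \<in> A) \<Longrightarrow> (\<And>i. coeff r i \<in> A) \<Longrightarrow> coeff (q + r) i \<in> A"
  by (simp add: add_closed)

lemma coeff_diff_closed: "(\<And>i. coeff q i \<in> A) \<Longrightarrow> (\<And>i. coeff r i \<in> A) \<Longrightarrow> coeff (q - r) i \<in> A"
  by (simp add: diff_closed)

lemma coeff_mult_closed: "(\<And>i. coeff q i \<in> A) \<Longrightarrow> (\<And>i. coeff r i \<in> A) \<Longrightarrow> coeff (q * r) i \<in> A"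
  unfolding coeff_mult by (intro sum_closed mult_closed) auto

lemma coeff_smult_closed: "c \<in> A \<Longrightarrow> (\<And>i. coeff q i \<in> A) \<Longrightarrow> coeff (smult c q) i \<in> A"
  by (simp add: mult_closed)

lemma coeff_pCons_closed: "c \<in> A \<Longrightarrow> (\<And>i. coeff q i \<in> A) \<Longrightarrow> coeff (pCons c q) i \<in> A"
  by (simp add: coeff_pCons split: nat.split)

lemma coeff_monom_closed: "c \<in> A \<Longrightarrow> coeff (monom c n) i \<in> A"
  by (auto intro: zero_closed)

lemma coeff_pcompose_closed:
  "(\<And>i. coeff q i \<in> A) \<Longrightarrow> (\<And>i. coeff r i \<in> A) \<Longrightarrow> coeff (pcompose q r) i \<in> A"
proof (induction q arbitrary: i)
  case 0
  then show ?case by (simp add: zero_closed)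
next
  case (pCons c q)
  have q: "coeff q j \<in> A" for j
    using pCons.prems(1)[of "Suc j"] by simp
  have "c \<in> A"
    using pCons.prems(1)[of 0] by simp
  then show ?case
    unfolding pcompose_pCons
    by (intro coeff_add_closed coeff_pCons_closed coeff_mult_closed pCons.IH q pCons.prems)
       (auto simp: zero_closed)
qed

end

section \<open>Extension rings \<open>A[x]\<close> and unions of chains\<close>

definition adjoin :: "'k::field set \<Rightarrow> 'k \<Rightarrow> 'k set" where
  "adjoin A x = {poly q x | q. \<forall>i. coeff q i \<in> A}"

lemma (in unital_subring) unital_subring_adjoin: "unital_subring (adjoin A x)"
proof
  have "\<forall>i. coeff [:1:] i \<in> A" "1 = poly [:1:] x"
    by (auto simp: coeff_pCons zero_closed one_closed split: nat.split)
  then show "1 \<in> adjoin A x"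
    unfolding adjoin_def by blast
next
  fix y z assume "y \<in> adjoin A x" "z \<in> adjoin A x"
  then obtain q r where q: "\<forall>i. coeff q i \<in> A" "y = poly q x" and r: "\<forall>i. coeff r i \<in> A" "z = poly r x"
    unfolding adjoin_def by blast
  have "y - z = poly (q - r) x" "y * z = poly (q * r) x"
    using q r by auto
  then show "y - z \<in> adjoin A x" "y * z \<in> adjoin A x"
    unfolding adjoin_def using q r coeff_diff_closed coeff_mult_closed by blast+
qed

lemma (in unital_subring) subset_adjoin: "A \<subseteq> adjoin A x"
proof
  fix y assume "y \<in> A"
  then have "\<forall>i. coeff [:y:] i \<in> A" "y = poly [:y:] x"
    by (auto simp: coeff_pCons zero_closed split: nat.split)
  then show "y \<in> adjoin A x" unfolding adjoin_def by blast
qed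

lemma (in unital_subring) self_in_adjoin: "x \<in> adjoin A x"
proof -
  have "\<forall>i. coeff [:0, 1:] i \<in> A" "x = poly [:0, 1:] x"
    by (auto simp: coeff_pCons zero_closed one_closed split: nat.split)
  then show ?thesis unfolding adjoin_def by blast
qed

lemma (in unital_subring) algebraic_over_mem: "x \<in> A \<Longrightarrow> algebraic_over A x"
  unfolding algebraic_over_def
  by (intro exI[of _ "[:- x, 1:]"]) (auto simp: coeff_pCons uminus_closed one_closed zero_closed split: nat.split)

lemma unital_subring_Union_chain:
  assumes "subset.chain {A. unital_subring A} \<C>" "\<C> \<noteq> {}"
  shows "unital_subring (\<Union>\<C>)"
proof
  have sub: "unital_subring A" if "A \<in> \<C>" for A
    using assms(1) that by (auto simp: subset.chain_def)
  show "1 \<in> \<Union>\<C>"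
    using assms(2) sub unital_subring.one_closed by fastforce
  fix x y assume "x \<in> \<Union>\<C>" "y \<in> \<Union>\<C>"
  then obtain A where "A \<in> \<C>" "x \<in> A" "y \<in> A"
    using subset.chain_total[OF assms(1)] by blast
  then show "x - y \<in> \<Union>\<C>" "x * y \<in> \<Union>\<C>"
    using sub unital_subring.diff_closed unital_subring.mult_closed by (metis UnionI)+
qed

text \<open>Valuation rings of arbitrary rank are meant, the whole field included. No value group is
  formed; sizes are compared through divisibility.\<close>

locale valuation_ring = unital_subring V for V :: "'k::field set" +
  assumes total: "x \<in> V \<or> inverse x \<in> V"
begin

text \<open>\<open>x \<preceq> y\<close> stands for \<open>|x| \<le> |y|\<close>, where \<open>|\<cdot>|\<close> is the valuation with ring \<open>V\<close>.\<close>

definition vle :: "'k \<Rightarrow> 'k \<Rightarrow> bool" (infix "\<preceq>" 50) where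
  "x \<preceq> y \<longleftrightarrow> (\<exists>c\<in>V. x = c * y)"

abbreviation vless :: "'k \<Rightarrow> 'k \<Rightarrow> bool" (infix "\<prec>" 50) where
  "x \<prec> y \<equiv> \<not> y \<preceq> x"

lemma vle_refl [simp]: "x \<preceq> x"
  unfolding vle_def by (metis mult_1 one_closed)

lemma vle_trans [trans]: "x \<preceq> y \<Longrightarrow> y \<preceq> z \<Longrightarrow> x \<preceq> z"
  unfolding vle_def by (metis mult.assoc mult_closed)

lemma zero_vle [simp]: "0 \<preceq> x"
  unfolding vle_def by (metis mult_zero_left zero_closed)

lemma vle_total: "x \<preceq> y \<or> y \<preceq> x"
proof (cases "x = 0 \<or> y = 0")
  case False
  then have "x = (x / y) * y" "y = inverse (x / y) * x" by auto
  then show ?thesis unfolding vle_def using total[of "x / y"] by blast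
qed auto

lemma vless_imp_vle: "x \<prec> y \<Longrightarrow> x \<preceq> y"
  using vle_total by blast

lemma vless_vle_trans [trans]: "x \<prec> y \<Longrightarrow> y \<preceq> z \<Longrightarrow> x \<prec> z"
  using vle_trans by blast

lemma vle_one_iff: "x \<preceq> 1 \<longleftrightarrow> x \<in> V"
  unfolding vle_def by auto

lemma vle_zero_iff: "x \<preceq> 0 \<longleftrightarrow> x = 0"
  by (auto simp: vle_def intro: zero_closed)

lemma one_vle_inverse: "x \<noteq> 0 \<Longrightarrow> x \<in> V \<Longrightarrow> 1 \<preceq> inverse x"
  unfolding vle_def by (rule bexI[of _ x]) auto

lemma vle_mult: "x \<preceq> y \<Longrightarrow> z \<preceq> w \<Longrightarrow> x * z \<preceq> y * w"
  unfolding vle_def by (metis mult.assoc mult.left_commute mult_closed)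

lemma vle_mult_cancel: "x * z \<preceq> y * z \<Longrightarrow> z \<noteq> 0 \<Longrightarrow> x \<preceq> y"
  unfolding vle_def by (metis mult.assoc mult_cancel_right)

lemma vless_mult: "x \<preceq> y \<Longrightarrow> z \<prec> w \<Longrightarrow> y \<noteq> 0 \<Longrightarrow> x * z \<prec> y * w"
proof
  assume *: "x \<preceq> y" "z \<prec> w" "y \<noteq> 0" "y * w \<preceq> x * z"
  have "x * z \<preceq> y * z" using * vle_mult vle_refl by blast
  then have "w * y \<preceq> z * y" using * vle_trans by (metis mult.commute)
  then show False using * vle_mult_cancel by blast
qed

lemma vle_power: "x \<preceq> y \<Longrightarrow> x ^ n \<preceq> y ^ n"
  by (induction n) (auto intro: vle_mult)

lemma vless_power: "x \<prec> y \<Longrightarrow> 0 < n \<Longrightarrow> x ^ n \<prec> y ^ n"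
proof (induction n)
  case (Suc n)
  have "y \<noteq> 0" using Suc.prems by auto
  then show ?case
    using vless_mult[OF vle_power[OF vless_imp_vle[OF Suc.prems(1)], of n] Suc.prems(1)]
    by (simp add: mult.commute)
qed simp

lemma vle_power_iff: "0 < n \<Longrightarrow> x ^ n \<preceq> y ^ n \<longleftrightarrow> x \<preceq> y"
  using vle_power vless_power by blast

lemma vle_power_mono: "1 \<preceq> x \<Longrightarrow> m \<le> n \<Longrightarrow> x ^ m \<preceq> x ^ n"
  using vle_mult[OF vle_power[of 1 x "n - m"] vle_refl[of "x ^ m"]]
  by (simp flip: power_add)

lemma vless_power_strict_mono: "1 \<prec> x \<Longrightarrow> m < n \<Longrightarrow> x ^ m \<prec> x ^ n"
proof -
  assume "1 \<prec> x" "m < n"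
  moreover from this have "x ^ m \<noteq> 0" by auto
  ultimately have "x ^ m * 1 ^ (n - m) \<prec> x ^ m * x ^ (n - m)"
    by (intro vless_mult vless_power) auto
  then show ?thesis
    using \<open>m < n\<close> by (simp flip: power_add)
qed

lemma vle_self_power: "1 \<preceq> x \<Longrightarrow> 0 < n \<Longrightarrow> x \<preceq> x ^ n"
  using vle_power_mono[of x 1 n] by simp

lemma one_vle_power: "1 \<preceq> x \<Longrightarrow> 1 \<preceq> x ^ n"
  using vle_power[of 1 x n] by simp

lemma vle_add: "x \<preceq> z \<Longrightarrow> y \<preceq> z \<Longrightarrow> x + y \<preceq> z"
  unfolding vle_def by (metis add_closed distrib_right)

lemma vle_uminus_iff: "- x \<preceq> y \<longleftrightarrow> x \<preceq> y" "x \<preceq> - y \<longleftrightarrow> x \<preceq> y"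
  unfolding vle_def by (metis minus_minus minus_mult_left minus_mult_right uminus_closed)+

lemma vle_diff: "x \<preceq> z \<Longrightarrow> y \<preceq> z \<Longrightarrow> x - y \<preceq> z"
  using vle_add[of x z "- y"] by (simp add: vle_uminus_iff)

lemma vle_sum: "(\<And>i. i \<in> I \<Longrightarrow> g i \<preceq> z) \<Longrightarrow> sum g I \<preceq> z"
  by (induction I rule: infinite_finite_induct) (auto intro: vle_add)

lemma vless_add: "x \<prec> z \<Longrightarrow> y \<prec> z \<Longrightarrow> x + y \<prec> z"
  using vle_total[of x y] vle_add[of x y y] vle_add[of x x y] vle_trans[of z "x + y"] vle_refl by blast

lemma vless_sum: "(\<And>i. i \<in> I \<Longrightarrow> g i \<prec> z) \<Longrightarrow> z \<noteq> 0 \<Longrightarrow> sum g I \<prec> z"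
  by (induction I rule: infinite_finite_induct) (simp_all add: vless_add vle_zero_iff)

text \<open>A strictly dominant term cannot be cancelled: otherwise \<open>y\<close>, being
  \<open>(x + y) + (- x)\<close>, would be a sum of two elements strictly smaller than
  itself.\<close>

lemma dominant_add: "x \<prec> y \<Longrightarrow> y \<preceq> x + y"
proof (rule ccontr)
  assume "x \<prec> y" "x + y \<prec> y"
  moreover from this have "- x \<prec> y" by (simp add: vle_uminus_iff)
  ultimately have "(x + y) + - x \<prec> y" using vless_add by blast
  then show False by simp
qed

lemma dominant_add_eq: assumes "x \<prec> y" shows "x + y \<preceq> y" "y \<preceq> x + y"
  using assms dominant_add vle_add vless_imp_vle by auto

lemma poly_vle:
  assumes "\<And>i. coeff q i \<in> V" "1 \<preceq> B" "x \<preceq> B" "degree q \<le> n"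
  shows "poly q x \<preceq> B ^ n"
  unfolding poly_altdef
proof (rule vle_sum)
  fix i assume i: "i \<in> {..degree q}"
  have "x ^ i \<preceq> B ^ n"
    using vle_trans[OF vle_power[OF assms(3)] vle_power_mono[OF assms(2)]] i assms(4) by auto
  then show "coeff q i * x ^ i \<preceq> B ^ n"
    using vle_mult[of "coeff q i" 1 "x ^ i" "B ^ n"] assms(1)[of i] by (simp add: vle_one_iff)
qed

lemma poly_vle_power_degree: "(\<And>i. coeff q i \<in> V) \<Longrightarrow> 1 \<preceq> x \<Longrightarrow> poly q x \<preceq> x ^ degree q"
  by (rule poly_vle) auto

text \<open>Outside the unit disc the top term strictly dominates all others, because the
  coefficients are integral and the leading one is not small. The lower bounds for polynomial values
  below come from this.\<close>

lemma power_degree_vle_poly: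
  assumes "\<And>i. coeff q i \<in> V" "1 \<preceq> lead_coeff q" "1 \<prec> x"
  shows "x ^ degree q \<preceq> poly q x"
proof -
  have x: "x \<noteq> 0" using assms(3) by auto
  let ?g = "\<lambda>i. coeff q i * x ^ i"
  have "(\<Sum>i<degree q. ?g i) \<prec> x ^ degree q"
  proof (rule vless_sum)
    fix i assume "i \<in> {..<degree q}"
    then have "x ^ i \<prec> x ^ degree q" using vless_power_strict_mono[OF assms(3)] by auto
    then show "?g i \<prec> x ^ degree q"
      using vless_mult[of "coeff q i" 1 "x ^ degree q" "x ^ i"] assms(1)[of i]
      unfolding vle_one_iff by simp
  qed (use x in auto)
  moreover have *: "x ^ degree q \<preceq> ?g (degree q)"
    using vle_mult[OF assms(2) vle_refl[of "x ^ degree q"]] by simp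
  ultimately have "(\<Sum>i<degree q. ?g i) \<prec> ?g (degree q)" using vless_vle_trans by blast
  then have "?g (degree q) \<preceq> poly q x"
    using dominant_add_eq(2) by (simp add: poly_altdef lessThan_Suc_atMost[symmetric])
  then show ?thesis using * vle_trans by blast
qed

lemma integral_closed:
  assumes "\<And>i. coeff q i \<in> V" "1 \<preceq> lead_coeff q" "poly q x = 0"
  shows "x \<in> V"
proof (rule ccontr)
  assume "x \<notin> V"
  then have x: "1 \<prec> x" by (simp add: vle_one_iff)
  then have "x \<noteq> 0" by auto
  then show False
    using power_degree_vle_poly[OF assms(1,2) x] assms(3) by (simp add: vle_zero_iff)
qed

lemma algebraic_over_imp_mem:
  assumes "algebraic_over F x" "F \<subseteq> V" "\<And>y. y \<in> F \<Longrightarrow> inverse y \<in> F"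
  shows "x \<in> V"
proof -
  obtain q where q: "q \<noteq> 0" "\<And>i. coeff q i \<in> F" "poly q x = 0"
    using assms(1) unfolding algebraic_over_def by blast
  have "1 \<preceq> inverse (inverse (lead_coeff q))"
    using q(1) assms(3)[OF q(2)] assms(2) by (intro one_vle_inverse) auto
  moreover have "\<And>i. coeff q i \<in> V" using q(2) assms(2) by auto
  ultimately show ?thesis using q(3) integral_closed[of q] by simp
qed

end

text \<open>The coefficients in reverse order give an equation for the inverse.\<close>

lemma algebraic_over_inverse:
  assumes "algebraic_over F x" shows "algebraic_over F (inverse x)"
proof (cases "x = 0")
  case False
  obtain q where q: "q \<noteq> 0" "\<And>i. coeff q i \<in> F" "poly q x = 0"
    using assms unfolding algebraic_over_def by blast
  obtain n r where qr: "q = monom 1 n * r" "poly r 0 \<noteq> 0"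
  proof -
    obtain r where "q = [:- 0, 1:] ^ order 0 q * r" "\<not> [:- 0, 1:] dvd r"
      using order_decomp[OF q(1)] by blast
    then show thesis
      using that[of "order 0 q" r] by (simp add: poly_eq_0_iff_dvd monom_altdef)
  qed
  have "coeff (reflect_poly r) i \<in> F" for i
  proof (cases "i \<le> degree r")
    case True
    then show ?thesis
      using q(2)[of "n + (degree r - i)"] True unfolding qr(1) coeff_monom_mult
      by (auto simp: coeff_reflect_poly split: if_splits)
  next
    case False
    \<comment> \<open>\<open>F\<close> is an arbitrary set, so even \<open>0 \<in> F\<close> has to
      be read off from a coefficient of \<open>q\<close> beyond its degree.\<close>
    have "coeff r (Suc (degree r)) = 0" by (simp add: coeff_eq_0)
    then show ?thesis
      using False q(2)[of "n + Suc (degree r)"] unfolding qr(1) coeff_monom_mult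
      by (simp add: coeff_reflect_poly)
  qed
  moreover have "reflect_poly r \<noteq> 0" using qr by auto
  moreover have "poly r x = 0" using q(3) qr(1) False by (simp add: poly_monom)
  then have "poly (reflect_poly r) (inverse x) = 0"
    using False by (simp add: poly_reflect_poly_nz)
  ultimately show ?thesis unfolding algebraic_over_def by blast
qed (use assms in simp)

section \<open>Existence of a valuation ring at which a given transcendental element has a
  pole\<close>

lemma (in unital_subring) coeff_reflect_poly_closed:
  "(\<And>i. coeff q i \<in> A) \<Longrightarrow> coeff (reflect_poly q) i \<in> A"
  by (simp add: coeff_reflect_poly zero_closed)

text \<open>If both \<open>z\<close> and \<open>1/z\<close> make \<open>y\<close> invertible over \<open>A\<close>, the two equations can be combined to
  one of smaller degree.\<close>

lemma (in unital_subring) unit_equation_descent: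
  assumes y: "y \<in> A" and units: "\<And>a. a \<in> A \<Longrightarrow> 1 - y * a \<noteq> 0 \<and> inverse (1 - y * a) \<in> A"
    and z: "z \<noteq> 0"
    and q: "\<And>i. coeff q i \<in> A" "y * poly q z = 1"
    and r: "\<And>i. coeff r i \<in> A" "y * poly r (inverse z) = 1"
    and le: "degree r \<le> degree q"
  obtains q' where "\<And>i. coeff q' i \<in> A" "y * poly q' z = 1" "degree q' < degree q"
proof -
  obtain r0 r1 where rr: "r = pCons r0 r1" by (cases r)
  have r1: "coeff r1 i \<in> A" for i
    using r(1)[of "Suc i"] rr by simp
  have r0: "r0 \<in> A" using r(1)[of 0] rr by simp
  define v where "v = inverse (1 - y * r0)"
  have v: "v \<in> A" "v * (1 - y * r0) = 1" using units[OF r0] unfolding v_def by auto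
  have u: "1 - y * r0 = y * inverse z * poly r1 (inverse z)"
    using r(2) unfolding rr by (simp add: algebra_simps)
  then have "r1 \<noteq> 0" using units[OF r0] by auto
  then have m: "degree r = Suc (degree r1)" using rr by simp
  let ?n = "degree q" and ?c = "lead_coeff q"
  let ?s = "monom 1 (?n - degree r) * reflect_poly r1"
  have "z ^ Suc (degree r1) * (v * (1 - y * r0)) = v * y * poly (reflect_poly r1) z"
    unfolding u poly_reflect_poly_nz[OF z] using z by (simp add: field_simps)
  then have "z ^ degree r = v * y * poly (reflect_poly r1) z"
    using v m by simp
  then have "z ^ (?n - degree r) * z ^ degree r = v * y * poly ?s z"
    by (simp add: poly_monom algebra_simps)
  then have zn: "z ^ ?n = v * y * poly ?s z"
    using le by (simp flip: power_add)
  \<comment> \<open>The second equation expresses \<open>z ^ ?n\<close> through lower powers of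
    \<open>z\<close> with coefficients in \<open>A\<close>; substituting this for the leading term
    of \<open>q\<close> lowers the degree.\<close>
  define q' where "q' = (q - monom ?c ?n) + smult (?c * v * y) ?s"
  have "poly q' z = poly q z"
    unfolding q'_def by (simp add: poly_monom zn algebra_simps)
  then have "y * poly q' z = 1" using q(2) by simp
  moreover have "coeff q' i \<in> A" for i
    unfolding q'_def
    by (intro coeff_add_closed coeff_diff_closed coeff_smult_closed coeff_mult_closed
        coeff_monom_closed coeff_reflect_poly_closed mult_closed q v y r1 one_closed)
  moreover have "degree q' \<le> ?n - 1"
    unfolding q'_def
  proof (rule degree_add_le)
    show "degree (q - monom ?c ?n) \<le> ?n - 1"
    proof (rule degree_le, intro allI impI)
      fix i assume "?n - 1 < i"
      then have "i = ?n \<or> i > ?n" using m le by auto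
      then show "coeff (q - monom ?c ?n) i = 0" by (auto simp: coeff_eq_0)
    qed
    have "degree ?s \<le> (?n - degree r) + degree r1"
      using degree_mult_le[of "monom 1 (?n - degree r) :: 'k poly" "reflect_poly r1"]
        degree_reflect_poly_le[of r1] by (simp add: degree_monom_eq)
    then show "degree (smult (?c * v * y) ?s) \<le> ?n - 1"
      using m le degree_smult_le[of "?c * v * y" ?s] by linarith
  qed
  ultimately show thesis using m le by (intro that[of q']) auto
qed

text \<open>A variant of Chevalley's extension theorem: a ring that contains \<open>F[1/x]\<close>
  and is maximal among those avoiding \<open>x\<close> is a valuation ring.\<close>

theorem exists_valuation_ring:
  assumes F: "unital_subring F" and x: "\<not> algebraic_over F x"
  obtains V where "valuation_ring V" "F \<subseteq> V" "x \<notin> V"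
proof -
  interpret F: unital_subring F by fact
  define y where "y = inverse x"
  have "x \<noteq> 0" using F.algebraic_over_mem[OF F.zero_closed] x by auto
  then have xy: "x * y = 1" unfolding y_def by simp
  \<comment> \<open>Multiplied by \<open>x ^ degree q\<close>, a relation
    \<open>x = poly q y\<close> would become a monic equation for \<open>x\<close> over
    \<open>F\<close>.\<close>
  have x_notin: "x \<notin> adjoin F y"
  proof
    assume "x \<in> adjoin F y"
    then obtain q where q: "\<And>i. coeff q i \<in> F" "x = poly q y" unfolding adjoin_def by blast
    define r where "r = monom 1 (Suc (degree q)) - reflect_poly q"
    have "poly (reflect_poly q) x = x ^ degree q * x"
      using poly_reflect_poly_nz[OF \<open>x \<noteq> 0\<close>, of q] unfolding y_def[symmetric] q(2)[symmetric] .
    then have "poly r x = 0"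
      by (simp add: r_def poly_monom mult.commute)
    moreover have "coeff r i \<in> F" for i
      unfolding r_def
      by (intro F.coeff_diff_closed F.coeff_monom_closed F.coeff_reflect_poly_closed q F.one_closed)
    moreover have "coeff r (Suc (degree q)) = 1"
      by (simp add: r_def coeff_reflect_poly)
    then have "r \<noteq> 0" by auto
    ultimately show False using x unfolding algebraic_over_def by blast
  qed
  let ?\<A> = "{A. unital_subring A \<and> adjoin F y \<subseteq> A \<and> x \<notin> A}"
  have "\<exists>A\<in>?\<A>. \<forall>X\<in>?\<A>. A \<subseteq> X \<longrightarrow> X = A"
  proof (rule subset_Zorn_nonempty)
    show "?\<A> \<noteq> {}" using F.unital_subring_adjoin x_notin by blast
    fix \<C> assume "\<C> \<noteq> {}" "subset.chain ?\<A> \<C>"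
    moreover from this have "unital_subring (\<Union>\<C>)"
      by (intro unital_subring_Union_chain) (auto simp: subset.chain_def)
    ultimately show "\<Union>\<C> \<in> ?\<A>" by (auto simp: subset.chain_def)
  qed
  then obtain A where "A \<in> ?\<A>" and max: "\<forall>X\<in>?\<A>. A \<subseteq> X \<longrightarrow> X = A" ..
  then have A: "unital_subring A" "adjoin F y \<subseteq> A" "x \<notin> A" by simp_all
  interpret unital_subring A by fact
  have "y \<in> A" using A(2) F.self_in_adjoin by auto
  have grow: "x \<in> adjoin A z" if "z \<notin> A" for z
  proof (rule ccontr)
    assume "x \<notin> adjoin A z"
    then have "adjoin A z \<in> ?\<A>"
      using unital_subring_adjoin[of z] subset_adjoin[of z] A(2) by auto
    then have "adjoin A z = A" using max subset_adjoin[of z] by blast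
    then show False using self_in_adjoin[of z] that by simp
  qed
  \<comment> \<open>In other words, \<open>y\<close> lies in the Jacobson radical of
    \<open>A\<close>.\<close>
  have units: "1 - y * a \<noteq> 0 \<and> inverse (1 - y * a) \<in> A" if a: "a \<in> A" for a
  proof
    let ?u = "1 - y * a"
    show u: "?u \<noteq> 0"
    proof
      assume "?u = 0"
      then have "a = x" using xy by (metis eq_iff_diff_eq_0 mult.commute mult.right_neutral mult.left_commute)
      then show False using a A(3) by simp
    qed
    show "inverse ?u \<in> A"
    proof (rule ccontr)
      assume "inverse ?u \<notin> A"
      then obtain q where q: "\<And>i. coeff q i \<in> A" "x = poly q (inverse ?u)"
        using grow unfolding adjoin_def by blast
      \<comment> \<open>Powers of \<open>?u\<close> are 1 modulo \<open>y * A\<close>, and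
        \<open>x * y = 1\<close>. So multiplying \<open>x = poly q (inverse ?u)\<close> by
        \<open>?u ^ degree q\<close> changes its left side only by an element of \<open>A\<close>,
        while the right side becomes an element of \<open>A\<close>.\<close>
      have "\<exists>c\<in>A. ?u ^ n = 1 - y * c" for n
      proof (induction n)
        case 0
        then show ?case by (intro bexI[of _ 0]) (auto intro: zero_closed)
      next
        case (Suc n)
        then obtain c where c: "c \<in> A" "?u ^ n = 1 - y * c" by blast
        have "?u ^ Suc n = 1 - y * (a + c - y * a * c)"
          unfolding power_Suc c(2) by (simp add: algebra_simps)
        moreover have "a + c - y * a * c \<in> A"
          using a \<open>y \<in> A\<close> c(1) by (intro add_closed diff_closed mult_closed)
        ultimately show ?case by blast
      qed
      then obtain c where c: "c \<in> A" "?u ^ degree q = 1 - y * c" by blast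
      have "poly (reflect_poly q) ?u = ?u ^ degree q * x"
        using poly_reflect_poly_nz[OF u, of q] unfolding q(2)[symmetric] .
      also have "\<dots> = x - c" unfolding c(2) using xy by (simp add: algebra_simps)
      finally have "x = poly (reflect_poly q) ?u + c" by simp
      moreover have "poly (reflect_poly q) ?u \<in> A"
        using \<open>y \<in> A\<close> a q(1)
        by (intro poly_closed coeff_reflect_poly_closed diff_closed mult_closed one_closed)
      ultimately show False using A(3) c(1) add_closed by metis
    qed
  qed
  \<comment> \<open>Infinite descent on the total degree, always lowering the longer of the two
    equations.\<close>
  have no_pair: False if "z \<noteq> 0" "\<And>i. coeff q i \<in> A" "\<And>i. coeff r i \<in> A"
      "y * poly q z = 1" "y * poly r (inverse z) = 1" for z q r
    using that
  proof (induction "degree q + degree r" arbitrary: z q r rule: less_induct)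
    case less
    show ?case
    proof (cases "degree r \<le> degree q")
      case True
      obtain q' where "\<And>i. coeff q' i \<in> A" "y * poly q' z = 1" "degree q' < degree q"
        using unit_equation_descent[OF \<open>y \<in> A\<close> units less.prems(1,2,4,3,5) True] by blast
      then show False using less.hyps[of q' r z] less.prems by simp
    next
      case False
      obtain r' where "\<And>i. coeff r' i \<in> A" "y * poly r' (inverse z) = 1" "degree r' < degree r"
        using unit_equation_descent[OF \<open>y \<in> A\<close> units, of "inverse z" r q] False less.prems by auto
      then show False using less.hyps[of q r' z] less.prems by simp
    qed
  qed
  have "z \<in> A \<or> inverse z \<in> A" for z
  proof (rule ccontr)
    assume z: "\<not> (z \<in> A \<or> inverse z \<in> A)"
    then obtain q r where "\<And>i. coeff q i \<in> A" "x = poly q z" "\<And>i. coeff r i \<in> A" "x = poly r (inverse z)"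
      using grow unfolding adjoin_def by blast
    moreover have "z \<noteq> 0" using z zero_closed by auto
    ultimately show False using no_pair[of z q r] xy by (simp add: mult.commute)
  qed
  then have "valuation_ring A" by unfold_locales
  then show thesis using that A F.subset_adjoin by blast
qed

section \<open>Fields of constants and bounds that are uniform in the valuation\<close>

lemma algebraic_over_chain_Union:
  assumes "subset.chain \<A> \<C>" "\<C> \<noteq> {}" "algebraic_over (\<Union>\<C>) x"
  obtains A where "A \<in> \<C>" "algebraic_over A x"
proof -
  obtain q where q: "q \<noteq> 0" "\<And>i. coeff q i \<in> \<Union>\<C>" "poly q x = 0"
    using assms(3) unfolding algebraic_over_def by blast
  have "coeff q i \<in> coeff q ` {..degree q} \<union> {0}" for i
    by (cases "i \<le> degree q") (auto simp: coeff_eq_0)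
  then have "range (coeff q) \<subseteq> coeff q ` {..degree q} \<union> {0}" by blast
  then have "finite (range (coeff q))" by (rule finite_subset) auto
  then obtain A where "A \<in> \<C>" "range (coeff q) \<subseteq> A"
    using finite_subset_Union_chain[OF _ _ assms(2,1), of "range (coeff q)"] q(2) by blast
  then show thesis using that q unfolding algebraic_over_def by blast
qed

text \<open>A sufficiently high power of \<open>a\<close> clears all denominators of the
  equation.\<close>

lemma (in unital_subring) algebraic_over_adjoin_inverse:
  assumes a: "a \<in> A" "a \<noteq> 0" and alg: "algebraic_over (adjoin A (inverse a)) t"
  shows "algebraic_over A t"
proof -
  obtain q where q: "q \<noteq> 0" "\<And>i. coeff q i \<in> adjoin A (inverse a)" "poly q t = 0"
    using alg unfolding algebraic_over_def by blast
  obtain P where P: "\<And>i j. coeff (P i) j \<in> A" "\<And>i. coeff q i = poly (P i) (inverse a)"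
    using q(2) unfolding adjoin_def by simp metis
  define N where "N = (\<Sum>i\<le>degree q. degree (P i))"
  have "coeff (smult (a ^ N) q) i \<in> A" for i
  proof (cases "i \<le> degree q")
    case True
    then have "degree (P i) \<le> N"
      unfolding N_def by (intro member_le_sum) auto
    then have "a ^ N = a ^ (N - degree (P i)) * a ^ degree (P i)"
      by (simp flip: power_add)
    then have "a ^ N * coeff q i = a ^ (N - degree (P i)) * poly (reflect_poly (P i)) a"
      using a(2) P(2)[of i] by (simp add: poly_reflect_poly_nz)
    moreover have "poly (reflect_poly (P i)) a \<in> A"
      by (intro poly_closed coeff_reflect_poly_closed P a)
    ultimately show ?thesis using a(1) by (simp add: mult_closed power_closed)
  next
    case False
    then show ?thesis by (simp add: coeff_eq_0 zero_closed)
  qed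
  then show ?thesis
    unfolding algebraic_over_def using q a(2) by (intro exI[of _ "smult (a ^ N) q"]) auto
qed

text \<open>The equation for \<open>t\<close> is a polynomial relation between \<open>x\<close> and
  \<open>t\<close>; collecting it by powers of \<open>x\<close> instead of \<open>t\<close> gives an
  equation for \<open>x\<close>.\<close>

lemma algebraic_over_exchange:
  assumes alg: "algebraic_over (adjoin F x) t" and trans: "\<not> algebraic_over F t"
  shows "algebraic_over (adjoin F t) x"
proof -
  obtain q where q: "q \<noteq> 0" "\<And>i. coeff q i \<in> adjoin F x" "poly q t = 0"
    using alg unfolding algebraic_over_def by blast
  obtain P where P: "\<And>i j. coeff (P i) j \<in> F" "\<And>i. coeff q i = poly (P i) x"
    using q(2) unfolding adjoin_def by simp metis
  have "coeff (P 0) (Suc (degree (P 0))) = 0" by (simp add: coeff_eq_0)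
  then have "0 \<in> F" using P(1) by metis
  let ?n = "degree q"
  define M where "M = (\<Sum>i\<le>?n. degree (P i))"
  have M: "degree (P i) \<le> M" if "i \<le> ?n" for i
    unfolding M_def using that by (intro member_le_sum) auto
  define Q where "Q j = (\<Sum>i\<le>?n. monom (coeff (P i) j) i)" for j
  have coeff_Q: "coeff (Q j) i = (if i \<le> ?n then coeff (P i) j else 0)" for i j
    unfolding Q_def by (simp add: coeff_sum)
  define R where "R = (\<Sum>j\<le>M. monom (poly (Q j) t) j)"
  have coeff_R: "coeff R j = (if j \<le> M then poly (Q j) t else 0)" for j
    unfolding R_def by (simp add: coeff_sum)
  have Pi: "poly (P i) x = (\<Sum>j\<le>M. coeff (P i) j * x ^ j)" if "i \<le> ?n" for i
    unfolding poly_altdef using M[OF that]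
    by (intro sum.mono_neutral_left) (auto simp: coeff_eq_0 not_le)
  have "poly R x = (\<Sum>j\<le>M. \<Sum>i\<le>?n. coeff (P i) j * t ^ i * x ^ j)"
    unfolding R_def Q_def by (simp add: poly_sum poly_monom sum_distrib_right)
  also have "\<dots> = (\<Sum>i\<le>?n. \<Sum>j\<le>M. coeff (P i) j * t ^ i * x ^ j)" by (rule sum.swap)
  also have "\<dots> = (\<Sum>i\<le>?n. poly (P i) x * t ^ i)"
    by (intro sum.cong) (simp_all add: Pi sum_distrib_left sum_distrib_right mult_ac)
  also have "\<dots> = 0" using q(3) by (simp add: poly_altdef P(2))
  finally have "poly R x = 0" .
  moreover have "coeff R j \<in> adjoin F t" for j
  proof -
    have "\<forall>i. coeff (if j \<le> M then Q j else 0) i \<in> F"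
      using P(1) \<open>0 \<in> F\<close> by (simp add: coeff_Q)
    moreover have "coeff R j = poly (if j \<le> M then Q j else 0) t" by (simp add: coeff_R)
    ultimately show ?thesis unfolding adjoin_def by blast
  qed
  moreover have "R \<noteq> 0"
  proof -
    \<comment> \<open>\<open>Q ?j\<close> is nonzero, since its coefficient at \<open>?n\<close> is
      the leading coefficient of \<open>P ?n\<close>. As \<open>t\<close> is transcendental, the
      value at \<open>t\<close> is nonzero too.\<close>
    let ?j = "degree (P ?n)"
    have "P ?n \<noteq> 0" using q(1) P(2)[of ?n] by auto
    then have "coeff (Q ?j) ?n \<noteq> 0" by (simp add: coeff_Q)
    then have "Q ?j \<noteq> 0" by auto
    moreover have "coeff (Q ?j) i \<in> F" for i using P(1) \<open>0 \<in> F\<close> by (simp add: coeff_Q)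
    ultimately have "poly (Q ?j) t \<noteq> 0" using trans unfolding algebraic_over_def by blast
    then have "coeff R ?j \<noteq> 0" using M[of ?n] by (simp add: coeff_R)
    then show ?thesis by auto
  qed
  ultimately show ?thesis unfolding algebraic_over_def by blast
qed

text \<open>A maximal subring over which \<open>t\<close> stays transcendental is a field, and over it everything
  has transcendence degree at most one.\<close>

lemma exists_field_of_constants:
  assumes "unital_subring A" "\<not> algebraic_over A t"
  obtains F where "unital_subring F" "A \<subseteq> F" "\<forall>y\<in>F. inverse y \<in> F"
    "\<not> algebraic_over F t" "\<forall>x. algebraic_over (adjoin F t) x"
proof -
  let ?\<A> = "{F. unital_subring F \<and> A \<subseteq> F \<and> \<not> algebraic_over F t}"
  have "\<exists>F\<in>?\<A>. \<forall>X\<in>?\<A>. F \<subseteq> X \<longrightarrow> X = F"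
  proof (rule subset_Zorn_nonempty)
    show "?\<A> \<noteq> {}" using assms by blast
    fix \<C> assume *: "\<C> \<noteq> {}" "subset.chain ?\<A> \<C>"
    then have "unital_subring (\<Union>\<C>)"
      by (intro unital_subring_Union_chain) (auto simp: subset.chain_def)
    moreover have "\<not> algebraic_over (\<Union>\<C>) t"
      using algebraic_over_chain_Union[OF *(2,1)] *(2) by (auto simp: subset.chain_def)
    moreover have "A \<subseteq> \<Union>\<C>" using * by (fastforce simp: subset.chain_def)
    ultimately show "\<Union>\<C> \<in> ?\<A>" by simp
  qed
  then obtain F where "F \<in> ?\<A>" and max: "\<forall>X\<in>?\<A>. F \<subseteq> X \<longrightarrow> X = F" ..
  then have F: "unital_subring F" "A \<subseteq> F" "\<not> algebraic_over F t" by simp_all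
  interpret unital_subring F by fact
  have grow: "algebraic_over (adjoin F z) t" if "z \<notin> F" for z
  proof (rule ccontr)
    assume "\<not> algebraic_over (adjoin F z) t"
    then have "adjoin F z \<in> ?\<A>"
      using unital_subring_adjoin[of z] subset_adjoin[of z] F(2) by auto
    then have "adjoin F z = F" using max subset_adjoin[of z] by blast
    then show False using self_in_adjoin[of z] that by simp
  qed
  have inv: "inverse y \<in> F" if "y \<in> F" for y
    using algebraic_over_adjoin_inverse[OF that] grow[of "inverse y"] F(3) zero_closed
    by (cases "y = 0") auto
  have "algebraic_over (adjoin F t) x" for x
  proof (cases "x \<in> F")
    case True
    then show ?thesis
      using unital_subring.algebraic_over_mem[OF unital_subring_adjoin] subset_adjoin by blast
  next
    case False
    show ?thesis by (rule algebraic_over_exchange[OF grow[OF False] F(3)])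
  qed
  then show thesis using that F inv by blast
qed

text \<open>With the leading term moved to one side, the others are at most
  \<open>M * x ^ (degree q - 1)\<close>, and the power of \<open>x\<close> cancels.\<close>

lemma (in valuation_ring) lead_coeff_root_vle:
  assumes "poly q x = 0" "0 < degree q" "\<And>i. coeff q i \<preceq> M" "1 \<preceq> x"
  shows "lead_coeff q * x \<preceq> M"
proof -
  have x: "x \<noteq> 0" using assms(4) by (auto simp: vle_zero_iff)
  obtain n where n: "degree q = Suc n" using assms(2) gr0_implies_Suc by blast
  have "lead_coeff q * x ^ Suc n = - (\<Sum>i\<le>n. coeff q i * x ^ i)"
    using assms(1) unfolding poly_altdef n by (simp add: add_eq_0_iff n)
  also have "\<dots> \<preceq> M * x ^ n"
    unfolding vle_uminus_iff
    by (intro vle_sum vle_mult assms vle_power_mono) auto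
  finally show ?thesis
    using vle_mult_cancel[of "lead_coeff q * x" "x ^ n" M] x by (simp add: mult.assoc)
qed

text \<open>The witness \<open>z\<close> is the leading coefficient of an equation for
  \<open>x\<close> over \<open>F[t]\<close>: a denominator of \<open>x\<close> wherever
  \<open>t\<close> is integral. The exponent \<open>h\<close> bounds the degrees in \<open>t\<close>
  of the coefficients. The point is that neither depends on \<open>V\<close>.\<close>

lemma uniform_pole_bound:
  assumes F: "\<forall>y\<in>F. inverse y \<in> F" and t: "\<not> algebraic_over F t"
    and alg: "algebraic_over (adjoin F t) x"
  obtains z h where "z \<noteq> 0"
    "\<forall>V. valuation_ring V \<and> F \<subseteq> V \<and> t \<in> V \<longrightarrow> z \<in> V \<and> x * z \<in> V"
    "\<forall>V. valuation_ring V \<and> F \<subseteq> V \<and> t \<notin> V \<longrightarrow>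
      valuation_ring.vle V z (t ^ h) \<and> valuation_ring.vle V x (t ^ h)"
proof -
  obtain R where R: "R \<noteq> 0" "\<And>i. coeff R i \<in> adjoin F t" "poly R x = 0"
    using alg unfolding algebraic_over_def by blast
  obtain Q where Q: "\<And>i j. coeff (Q i) j \<in> F" "\<And>i. coeff R i = poly (Q i) t"
    using R(2) unfolding adjoin_def by simp metis
  let ?n = "degree R"
  define h where "h = (\<Sum>i\<le>?n. degree (Q i))"
  have "?n \<noteq> 0"
  proof
    assume "?n = 0"
    then obtain c where "R = [:c:]" by (auto elim: degree_eq_zeroE)
    then show False using R by simp
  qed
  then have n: "0 < ?n" by simp
  have "(t \<in> V \<longrightarrow> lead_coeff R \<in> V \<and> x * lead_coeff R \<in> V) \<and> (t \<notin> V \<longrightarrow>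
      valuation_ring.vle V (lead_coeff R) (t ^ h) \<and> valuation_ring.vle V x (t ^ h))"
    if "valuation_ring V" and FV: "F \<subseteq> V" for V
  proof -
    interpret valuation_ring V by fact
    have QV: "coeff (Q i) j \<in> V" for i j using Q(1) FV by auto
    have "lead_coeff R \<in> V \<and> x * lead_coeff R \<in> V" if "t \<in> V"
    proof -
      have RV: "coeff R i \<in> V" for i
        unfolding Q(2) by (intro poly_closed QV that)
      have "lead_coeff R * x \<in> V"
      proof (cases "vle 1 x")
        case True
        then show ?thesis
          using lead_coeff_root_vle[OF R(3) n, of 1] RV by (simp add: vle_one_iff)
      next
        case False
        then have "x \<in> V" using vless_imp_vle vle_one_iff by blast
        then show ?thesis using RV mult_closed by blast
      qed
      then show ?thesis
        using RV by (simp add: mult.commute)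
    qed
    moreover have "vle (lead_coeff R) (t ^ h) \<and> vle x (t ^ h)" if "t \<notin> V"
    proof -
      have t1: "\<not> vle t 1" using that by (simp add: vle_one_iff)
      then have t1': "vle 1 t" by (rule vless_imp_vle)
      have Rh: "vle (coeff R i) (t ^ h)" for i
      proof (cases "i \<le> ?n")
        case True
        then have "degree (Q i) \<le> h" unfolding h_def by (intro member_le_sum) auto
        then show ?thesis unfolding Q(2) by (intro poly_vle QV t1') auto
      qed (simp add: coeff_eq_0)
      \<comment> \<open>Since \<open>F\<close> is closed under inverses, the leading coefficient of
        \<open>Q ?n\<close> is a unit of \<open>V\<close>. So at a pole of \<open>t\<close> the
        leading coefficient of \<open>R\<close> has size at least 1, and \<open>x\<close> is no
        larger than its product with it.\<close>
      have "Q ?n \<noteq> 0" using R(1) Q(2)[of ?n] by auto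
      then have "vle 1 (inverse (inverse (lead_coeff (Q ?n))))"
        using F Q(1)[of ?n] FV by (intro one_vle_inverse) auto
      then have "vle (t ^ degree (Q ?n)) (lead_coeff R)"
        unfolding Q(2) using power_degree_vle_poly[OF QV _ t1] by simp
      then have z1: "vle 1 (lead_coeff R)" using one_vle_power[OF t1'] vle_trans by blast
      have "vle x (t ^ h)"
      proof (cases "vle 1 x")
        case True
        have "vle (1 * x) (lead_coeff R * x)" using z1 vle_mult vle_refl by blast
        also have "vle \<dots> (t ^ h)" by (rule lead_coeff_root_vle[OF R(3) n Rh True])
        finally show ?thesis by simp
      next
        case False
        then show ?thesis using vless_imp_vle one_vle_power[OF t1'] vle_trans by blast
      qed
      then show ?thesis using Rh by blast
    qed
    ultimately show ?thesis by blast
  qed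
  then show thesis using that[of "lead_coeff R" h] R(1) by simp
qed

section \<open>Absolute units\<close>

text \<open>These are the elements that no valuation sees. Nonzero elements algebraic over the prime
  field are of this kind, and only this consequence of algebraicity is needed for leading
  coefficients.\<close>

definition absolute_unit :: "'k::field \<Rightarrow> bool" where
  "absolute_unit u \<longleftrightarrow> u \<noteq> 0 \<and> (\<forall>V. valuation_ring V \<longrightarrow> u \<in> V \<and> inverse u \<in> V)"

lemma absolute_unit_mult: "absolute_unit u \<Longrightarrow> absolute_unit v \<Longrightarrow> absolute_unit (u * v)"
  unfolding absolute_unit_def
  by (auto simp: valuation_ring_def intro: unital_subring.mult_closed)

lemma absolute_unit_one: "absolute_unit 1"
  unfolding absolute_unit_def by (simp add: unital_subring.one_closed valuation_ring_def)

lemma absolute_unit_power: "absolute_unit u \<Longrightarrow> absolute_unit (u ^ n)"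
  by (induction n) (auto intro: absolute_unit_mult absolute_unit_one)

lemma absolute_unit_minus: "absolute_unit u \<Longrightarrow> absolute_unit (- u)"
  unfolding absolute_unit_def
  by (auto simp: valuation_ring_def intro: unital_subring.uminus_closed)

lemma (in valuation_ring) absolute_unit_mem: "absolute_unit u \<Longrightarrow> u \<in> V"
  unfolding absolute_unit_def using valuation_ring_axioms by blast

lemma (in valuation_ring) absolute_unit_ge: "absolute_unit u \<Longrightarrow> 1 \<preceq> u"
  using one_vle_inverse[of "inverse u"] valuation_ring_axioms unfolding absolute_unit_def by auto

lemma unital_subring_range_of_int: "unital_subring (range of_int :: 'k::field set)"
proof
  show "1 \<in> range (of_int :: int \<Rightarrow> 'k)" using range_eqI[of 1 of_int 1] by simp
qed (auto simp flip: of_int_diff of_int_mult)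

lemma range_of_int_inverse_closed:
  assumes "prime CHAR('k::field)" and "y \<in> range (of_int :: int \<Rightarrow> 'k)"
  shows "inverse y \<in> range (of_int :: int \<Rightarrow> 'k)"
proof (cases "y = 0")
  case True
  then show ?thesis by (simp add: range_eqI[of _ of_int 0])
next
  case False
  obtain a where a: "y = of_int a" using assms(2) by auto
  then have "\<not> int CHAR('k) dvd a" using False of_int_eq_0_iff_char_dvd by metis
  then have "coprime (int CHAR('k)) a" using assms(1) by (simp add: prime_imp_coprime)
  then obtain u v where "u * int CHAR('k) + v * a = 1"
    using coprime_iff_gcd_eq_1 bezout_int by metis
  then have "of_int (u * int CHAR('k) + v * a) = (1 :: 'k)" by simp
  then have "of_int v * y = 1" by (simp add: a)
  then have "inverse y = of_int v" by (metis inverse_unique mult.commute)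
  then show ?thesis by simp
qed

text \<open>Every valuation ring contains the prime field and is integrally closed, and inverses of
  algebraic elements are algebraic.\<close>

lemma algebraic_over_imp_absolute_unit:
  assumes "prime CHAR('k::field)" and "algebraic_over (range of_int) (u :: 'k)" "u \<noteq> 0"
  shows "absolute_unit u"
  unfolding absolute_unit_def
proof (intro conjI allI impI)
  fix V :: "'k set" assume "valuation_ring V"
  then interpret valuation_ring V .
  have sub: "range of_int \<subseteq> V" using of_int_closed by auto
  show "u \<in> V" "inverse u \<in> V"
    using algebraic_over_imp_mem[OF _ sub range_of_int_inverse_closed[OF assms(1)]]
      assms(2) algebraic_over_inverse by blast+
qed fact

lemma absolute_unit_of_nat:
  assumes "prime CHAR('k::field)" "\<not> CHAR('k) dvd n"
  shows "absolute_unit (of_nat n :: 'k)"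
proof (rule algebraic_over_imp_absolute_unit)
  have "of_nat n \<in> range (of_int :: int \<Rightarrow> 'k)" by (rule range_eqI[of _ _ "int n"]) simp
  then show "algebraic_over (range of_int) (of_nat n :: 'k)"
    by (rule unital_subring.algebraic_over_mem[OF unital_subring_range_of_int])
qed (use assms of_nat_eq_0_iff_char_dvd in auto)

section \<open>A transfinite diameter estimate\<close>

text \<open>Comparison of the coefficients at \<open>n\<close> in Lagrange's interpolation formula,
  whose basis polynomials \<open>L x\<close> are monic of degree \<open>n\<close>.\<close>

lemma coeff_lagrange_interpolation:
  fixes h :: "'k::field poly"
  assumes "finite T" "card T = Suc n" "degree h \<le> n"
  shows "coeff h n = (\<Sum>x\<in>T. poly h x / (\<Prod>y\<in>T - {x}. (x - y)))"
proof -
  define L where "L x = (\<Prod>y\<in>T - {x}. [:- y, 1:])" for x :: 'k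
  define c where "c x = poly h x / (\<Prod>y\<in>T - {x}. (x - y))" for x
  have deg: "degree (L x) = n" if "x \<in> T" for x
    using assms that unfolding L_def by (subst degree_prod_eq_sum_degree) auto
  have lead: "coeff (L x) n = 1" if "x \<in> T" for x
    using lead_coeff_prod[of "\<lambda>y. [:- y, 1:]" "T - {x}"] deg[OF that] unfolding L_def by simp
  have "h = (\<Sum>x\<in>T. smult (c x) (L x))"
  proof (rule poly_eqI_degree)
    fix z assume z: "z \<in> T"
    have "poly (L x) z = 0" if "x \<in> T" "x \<noteq> z" for x
      unfolding L_def poly_prod using assms(1) z that by auto
    then have "(\<Sum>x\<in>T. poly (smult (c x) (L x)) z) = (\<Sum>x\<in>T. if x = z then c z * poly (L z) z else 0)"
      by (intro sum.cong) auto
    also have "\<dots> = c z * poly (L z) z" using z assms(1) by simp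
    also have "\<dots> = poly h z" unfolding c_def L_def poly_prod using assms(1) by (simp add: prod_zero_iff)
    finally show "poly h z = poly (\<Sum>x\<in>T. smult (c x) (L x)) z" by (simp add: poly_sum)
  next
    show "degree h < card T" using assms by simp
    have "degree (\<Sum>x\<in>T. smult (c x) (L x)) \<le> n"
      using assms(1) deg by (intro degree_sum_le order_trans[OF degree_smult_le]) auto
    then show "degree (\<Sum>x\<in>T. smult (c x) (L x)) < card T" using assms by simp
  qed
  then have "coeff h n = (\<Sum>x\<in>T. c x * coeff (L x) n)"
    by (metis (no_types, lifting) coeff_smult coeff_sum sum.cong)
  then show ?thesis using lead unfolding c_def by simp
qed

text \<open>Both orders of each pair occur, so up to sign this is the square of the Vandermonde
  determinant, and no enumeration of \<open>T\<close> is needed.\<close>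

definition set_discriminant :: "'k::field set \<Rightarrow> 'k" where
  "set_discriminant T = (\<Prod>x\<in>T. \<Prod>y\<in>T - {x}. (x - y))"

lemma set_discriminant_nonzero: "finite T \<Longrightarrow> set_discriminant T \<noteq> 0"
  unfolding set_discriminant_def by (simp add: prod_zero_iff)

lemma set_discriminant_remove:
  assumes "finite T" "x \<in> T"
  shows "set_discriminant T =
    (- 1) ^ card (T - {x}) * (\<Prod>y\<in>T - {x}. (x - y))\<^sup>2 * set_discriminant (T - {x})"
proof -
  let ?S = "T - {x}"
  have "(\<Prod>z\<in>?S. \<Prod>y\<in>T - {z}. (z - y)) = (\<Prod>z\<in>?S. (z - x) * (\<Prod>y\<in>?S - {z}. (z - y)))"
  proof (rule prod.cong)
    fix z assume "z \<in> ?S"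
    then have "T - {z} = insert x (?S - {z})" using assms(2) by auto
    then show "(\<Prod>y\<in>T - {z}. (z - y)) = (z - x) * (\<Prod>y\<in>?S - {z}. (z - y))"
      using assms(1) by simp
  qed simp
  also have "\<dots> = (\<Prod>z\<in>?S. - 1 * (x - z)) * set_discriminant ?S"
    by (simp add: prod.distrib set_discriminant_def)
  also have "(\<Prod>z\<in>?S. - 1 * (x - z)) = (- 1) ^ card ?S * (\<Prod>z\<in>?S. (x - z))"
    by (subst prod.distrib) simp
  finally show ?thesis
    using prod.remove[OF assms, of "\<lambda>z. \<Prod>y\<in>T - {z}. (z - y)"]
    by (simp add: set_discriminant_def power2_eq_square mult_ac)
qed

context valuation_ring
begin

lemma finite_vle_maximal:
  assumes "finite T" "T \<noteq> {}"
  obtains x where "x \<in> T" "\<And>y. y \<in> T \<Longrightarrow> g y \<preceq> g x"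
  using assms
proof (induction T arbitrary: thesis rule: finite_ne_induct)
  case (singleton x)
  then show ?case by simp
next
  case (insert x T)
  obtain z where z: "z \<in> T" "\<And>y. y \<in> T \<Longrightarrow> g y \<preceq> g z" using insert.IH by blast
  show ?case
  proof (cases "g x \<preceq> g z")
    case True
    then show ?thesis using z insert.prems[of z] by auto
  next
    case False
    then have "g z \<preceq> g x" by (rule vless_imp_vle)
    then have "g y \<preceq> g x" if "y \<in> insert x T" for y
      using that z(2) vle_trans by auto
    then show ?thesis using insert.prems[of x] by blast
  qed
qed

text \<open>The determinant estimate for the matrix of the values \<open>h\<^sub>n(x)\<close>, obtained by removing from \<open>T\<close>
  the point that dominates Lagrange's formula for the leading coefficient.\<close>

theorem set_discriminant_vle:
  assumes "finite T" "\<And>n. degree (h n) \<le> n"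
    and "\<And>n x. x \<in> T \<Longrightarrow> poly (h n) x \<preceq> b n"
  shows "set_discriminant T * (\<Prod>n<card T. coeff (h n) n)\<^sup>2 \<preceq> (\<Prod>n<card T. b n)\<^sup>2"
  using assms(1,3)
proof (induction "card T" arbitrary: T)
  case 0
  then show ?case by (simp add: set_discriminant_def)
next
  case (Suc n)
  have "T \<noteq> {}" using Suc.hyps(2) by auto
  define g where "g x = (\<Prod>y\<in>T - {x}. (x - y))" for x
  have gnz: "g x \<noteq> 0" for x unfolding g_def using Suc.prems(1) by (simp add: prod_zero_iff)
  \<comment> \<open>The point with the smallest \<open>g x\<close> bounds every summand of
    Lagrange's formula. The square of this \<open>g x\<close> is, up to sign, the factor by which
    removing \<open>x\<close> changes the discriminant.\<close>
  obtain x where x: "x \<in> T" "\<And>y. y \<in> T \<Longrightarrow> inverse (g y) \<preceq> inverse (g x)"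
    using finite_vle_maximal[OF Suc.prems(1) \<open>T \<noteq> {}\<close>, of "\<lambda>y. inverse (g y)"] by blast
  have "coeff (h n) n = (\<Sum>y\<in>T. poly (h n) y / g y)"
    unfolding g_def using Suc.prems(1) Suc.hyps(2) assms(2)
    by (intro coeff_lagrange_interpolation) auto
  also have "\<dots> \<preceq> b n * inverse (g x)"
    unfolding divide_inverse using Suc.prems(2) x by (intro vle_sum vle_mult) auto
  finally have "coeff (h n) n * g x \<preceq> b n * inverse (g x) * g x"
    by (intro vle_mult) auto
  then have top: "(coeff (h n) n * g x)\<^sup>2 \<preceq> (b n)\<^sup>2"
    using gnz[of x] by (intro vle_power) (simp add: mult.assoc)
  let ?S = "T - {x}"
  have S: "card ?S = n" using Suc.hyps(2) Suc.prems(1) x(1) by simp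
  then have IH: "set_discriminant ?S * (\<Prod>n<n. coeff (h n) n)\<^sup>2 \<preceq> (\<Prod>n<n. b n)\<^sup>2"
    using Suc.hyps(1)[of ?S] Suc.prems by auto
  have "set_discriminant T * (\<Prod>n<Suc n. coeff (h n) n)\<^sup>2 =
      (- 1) ^ n * ((coeff (h n) n * g x)\<^sup>2 * (set_discriminant ?S * (\<Prod>n<n. coeff (h n) n)\<^sup>2))"
    using set_discriminant_remove[OF Suc.prems(1) x(1)] S
    by (simp add: g_def power_mult_distrib mult_ac)
  also have "\<dots> \<preceq> 1 * ((b n)\<^sup>2 * (\<Prod>n<n. b n)\<^sup>2)"
    using one_closed by (intro vle_mult top IH) (simp add: vle_one_iff power_closed uminus_closed)
  finally show ?case
    using Suc.hyps(2)[symmetric] by (simp add: power_mult_distrib mult.commute)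
qed

end

text \<open>Each quotient below \<open>I\<close> is taken \<open>e\<close> times. The factor 2 comes
  from the square in the determinant estimate.\<close>

lemma sum_div_lessThan: "0 < e \<Longrightarrow> 2 * (\<Sum>n<e * I. n div e) = e * I * (I - 1)" for e I :: nat
proof (induction I)
  case (Suc I)
  have "{..<e * Suc I} = {..<e * I} \<union> {e * I..<e * I + e}" by auto
  then have "(\<Sum>n<e * Suc I. n div e) = (\<Sum>n<e * I. n div e) + (\<Sum>n\<in>{e * I..<e * I + e}. n div e)"
    by (simp add: sum.union_disjoint ivl_disj_int)
  also have "(\<Sum>n\<in>{e * I..<e * I + e}. n div e) = (\<Sum>n\<in>{e * I..<e * I + e}. I)"
    using Suc.prems by (intro sum.cong refl) (auto intro!: div_nat_eqI simp: mult.commute)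
  finally show ?case using Suc by (cases I) (auto simp: algebra_simps)
qed simp

text \<open>The determinant estimate for the basis \<open>Q ^ (n div e) * X ^ (n mod e)\<close> with
  \<open>e = degree Q\<close>. The powers of \<open>Q\<close> give exponents quadratic in
  \<open>I\<close>, while the crude bound for the remaining power of the variable costs only a term
  linear in \<open>I\<close>.\<close>

lemma (in valuation_ring) set_discriminant_vle_power:
  assumes T: "finite T" "card T = degree Q * I" and e: "0 < degree Q" and B: "1 \<preceq> B"
    and le: "\<And>x. x \<in> T \<Longrightarrow> x \<preceq> B ^ d" "\<And>x. x \<in> T \<Longrightarrow> poly Q x \<preceq> B"
  shows "set_discriminant T * lead_coeff Q ^ (degree Q * I * (I - 1)) \<preceq>
    B ^ (degree Q * I * (I - 1) + 2 * d * degree Q * (degree Q * I))"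
proof -
  let ?e = "degree Q"
  define h where "h n = Q ^ (n div ?e) * monom 1 (n mod ?e)" for n
  have Q: "Q \<noteq> 0" using e by auto
  have deg: "degree (h n) = n" for n
    unfolding h_def using Q by (simp add: degree_mult_eq degree_power_eq degree_monom_eq)
  have "lead_coeff (h n) = lead_coeff Q ^ (n div ?e)" for n
    unfolding h_def by (simp add: lead_coeff_mult lead_coeff_power degree_monom_eq)
  then have lead: "coeff (h n) n = lead_coeff Q ^ (n div ?e)" for n
    using deg by simp
  have val: "poly (h n) x \<preceq> B ^ (n div ?e + d * ?e)" if "x \<in> T" for n x
  proof -
    have "x ^ (n mod ?e) \<preceq> (B ^ d) ^ (n mod ?e)" by (rule vle_power[OF le(1)[OF that]])
    also have "\<dots> \<preceq> B ^ (d * ?e)"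
      unfolding power_mult[symmetric] using e by (intro vle_power_mono B mult_le_mono2) (simp add: less_imp_le)
    finally have "x ^ (n mod ?e) \<preceq> B ^ (d * ?e)" .
    then show ?thesis
      unfolding h_def by (simp add: poly_monom power_add vle_mult vle_power le that)
  qed
  have "set_discriminant T * (\<Prod>n<?e * I. lead_coeff Q ^ (n div ?e))\<^sup>2 \<preceq>
      (\<Prod>n<?e * I. B ^ (n div ?e + d * ?e))\<^sup>2"
    using set_discriminant_vle[OF T(1), of h, OF _ val] deg unfolding T(2) lead by simp
  moreover have "(\<Prod>n<?e * I. lead_coeff Q ^ (n div ?e))\<^sup>2 = lead_coeff Q ^ (?e * I * (I - 1))"
    using sum_div_lessThan[OF e, of I]
    by (simp add: mult.commute flip: power_sum power_mult)
  moreover have "(\<Prod>n<?e * I. B ^ (n div ?e + d * ?e))\<^sup>2 = B ^ (2 * (\<Sum>n<?e * I. n div ?e + d * ?e))"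
    by (simp add: mult.commute flip: power_sum power_mult)
  moreover have "2 * (\<Sum>n<?e * I. n div ?e + d * ?e) = ?e * I * (I - 1) + 2 * d * ?e * (?e * I)"
    using sum_div_lessThan[OF e, of I] by (simp add: sum.distrib algebra_simps)
  ultimately show ?thesis by simp
qed

section \<open>Orbits as polynomials in the parameter\<close>

primrec orbit_poly :: "'k::field poly \<Rightarrow> 'k \<Rightarrow> nat \<Rightarrow> 'k poly" where
  "orbit_poly f \<alpha> 0 = [:\<alpha>:]"
| "orbit_poly f \<alpha> (Suc k) = pcompose f (orbit_poly f \<alpha> k) + [:0, 1:]"

lemma poly_orbit_poly: "poly (orbit_poly f \<alpha> k) \<mu> = (shifted f \<mu> ^^ k) \<alpha>"
  by (induction k) (simp_all add: poly_pcompose shifted_def)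

lemma orbit_poly_one: "orbit_poly f \<alpha> (Suc 0) = [:poly f \<alpha>, 1:]"
  by (simp add: pcompose_pCons_0)

lemma (in unital_subring) coeff_orbit_poly_closed:
  assumes "\<And>i. coeff f i \<in> A" "\<alpha> \<in> A"
  shows "coeff (orbit_poly f \<alpha> k) i \<in> A"
proof (induction k arbitrary: i)
  case 0
  then show ?case using assms by (auto simp: coeff_pCons zero_closed split: nat.split)
next
  case (Suc k)
  have "coeff [:0, 1:] i \<in> A" for i
    by (auto simp: coeff_pCons zero_closed one_closed split: nat.split)
  then show ?case
    unfolding orbit_poly.simps using assms Suc by (intro coeff_add_closed coeff_pcompose_closed)
qed

text \<open>Frobenius pulls out the exponent \<open>q\<close>, and the cofactor of
  \<open>x - y\<close> in \<open>x ^ s - y ^ s\<close> has top coefficient \<open>s\<close> times a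
  power of the common leading coefficient, which is nonzero because the characteristic does not
  divide \<open>s\<close>.\<close>

lemma power_diff_char:
  fixes x y :: "'k::field poly"
  assumes "prime CHAR('k)" and same: "degree y = degree x" "lead_coeff y = lead_coeff x"
    and "x \<noteq> y" "\<not> CHAR('k) dvd s" and q: "q = CHAR('k) ^ l"
  shows "degree (x ^ (q * s) - y ^ (q * s)) = q * ((s - 1) * degree x + degree (x - y))"
    and "lead_coeff (x ^ (q * s) - y ^ (q * s)) =
      (of_nat s * lead_coeff x ^ (s - 1) * lead_coeff (x - y)) ^ q"
proof -
  obtain n where n: "s = Suc n" using assms(5) by (cases s) auto
  have "x \<noteq> 0 \<and> y \<noteq> 0" using same assms(4) by (metis degree_0 leading_coeff_0_iff)
  then have nz: "x \<noteq> 0" "y \<noteq> 0" by auto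
  let ?t = "\<lambda>i. x ^ i * y ^ (n - i)" and ?D = "degree x"
  define S where "S = (\<Sum>i<Suc n. ?t i)"
  have deg_t: "degree (?t i) = n * ?D" if "i < Suc n" for i
    using nz same(1) that
    by (simp add: degree_mult_eq degree_power_eq flip: add_mult_distrib)
  have "coeff (?t i) (n * ?D) = lead_coeff x ^ n" if "i < Suc n" for i
  proof -
    have "lead_coeff (?t i) = lead_coeff x ^ i * lead_coeff x ^ (n - i)"
      using same(2) by (simp add: lead_coeff_mult lead_coeff_power)
    then show ?thesis using deg_t[OF that] that by (simp flip: power_add)
  qed
  then have coeff_S: "coeff S (n * ?D) = of_nat s * lead_coeff x ^ n"
    unfolding S_def coeff_sum n by (subst sum.cong[OF refl, of _ _ "\<lambda>_. lead_coeff x ^ n"]) auto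
  have "of_nat s \<noteq> (0 :: 'k)" using assms(5) by (simp add: of_nat_eq_0_iff_char_dvd)
  then have "coeff S (n * ?D) \<noteq> 0" using coeff_S nz by simp
  moreover have "degree S \<le> n * ?D" unfolding S_def using deg_t by (intro degree_sum_le) auto
  ultimately have deg_S: "degree S = n * ?D" by (simp add: le_antisym le_degree)
  have S_nz: "S \<noteq> 0" using \<open>coeff S (n * ?D) \<noteq> 0\<close> by auto
  have "x ^ s = (x ^ s - y ^ s) + y ^ s" by simp
  then have "(x ^ s) ^ q = (x ^ s - y ^ s) ^ q + (y ^ s) ^ q"
    using freshmans_dream'[of q l "x ^ s - y ^ s" "y ^ s"] assms(1) q by simp
  then have "x ^ (q * s) - y ^ (q * s) = (x ^ s - y ^ s) ^ q"
    unfolding mult.commute[of q] power_mult by simp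
  then have eq: "x ^ (q * s) - y ^ (q * s) = ((x - y) * S) ^ q"
    unfolding S_def diff_power_eq_sum[symmetric] n .
  have xy: "x - y \<noteq> 0" using assms(4) by simp
  show "degree (x ^ (q * s) - y ^ (q * s)) = q * ((s - 1) * degree x + degree (x - y))"
    unfolding eq using xy S_nz deg_S n by (simp add: degree_power_eq degree_mult_eq)
  show "lead_coeff (x ^ (q * s) - y ^ (q * s)) =
      (of_nat s * lead_coeff x ^ (s - 1) * lead_coeff (x - y)) ^ q"
    unfolding eq using coeff_S deg_S n by (simp add: lead_coeff_power lead_coeff_mult mult.commute)
qed

text \<open>The arithmetic behind \<open>first_slope\<close>, with
  \<open>e1, e2, q1, q2, d1, d2\<close> for \<open>a, b, q, q', d, d'\<close>. The surplus
  \<open>w\<close> equals \<open>d' - d\<close>, hence is at least \<open>q\<close>, and the claim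
  reduces to \<open>\<delta> * q < b * w\<close>.\<close>

lemma slope_inequality:
  fixes a b q q' d d' :: nat
  assumes "b < a" "a + q = d" "b + q' = d'" "d + q \<le> d'" "q' \<le> b" "0 < q"
  shows "(a - b) * d' < (q' - q) * a"
proof -
  define \<delta> w where "\<delta> = a - b" and "w = q' - q - \<delta>"
  have a: "a = b + \<delta>" using assms(1) by (simp add: \<delta>_def)
  have q': "q' = q + \<delta> + w" and "q \<le> w" using assms(2-4) a unfolding w_def by linarith+
  have "\<delta> < b" using q' assms(5,6) by linarith
  then have "\<delta> * q < b * q" using assms(6) by simp
  also have "\<dots> \<le> b * w" using \<open>q \<le> w\<close> by simp
  finally have "\<delta> * q < b * w" .
  moreover have "d' = b + q + \<delta> + w" "q' - q = \<delta> + w" using assms(3) q' by simp_all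
  ultimately show ?thesis unfolding \<delta>_def[symmetric] a by (simp add: algebra_simps)
qed

section \<open>The binomial family and the leading terms of orbit differences\<close>

locale binomial_family =
  fixes p :: nat and f :: "'k::alg_closed_field poly" and c1 c2 :: 'k
    and d1 d2 l1 l2 s1 s2 :: nat
  assumes prime_p: "prime p" and char: "CHAR('k) = p"
    and f_eq: "f = monom c1 d1 + monom c2 d2"
    and c1: "absolute_unit c1" and c2: "absolute_unit c2"
    and d12: "1 \<le> d1" "d1 < d2"
    and d1: "d1 = p ^ l1 * s1" "\<not> p dvd s1"
    and d2: "d2 = p ^ l2 * s2" "\<not> p dvd s2"
    and s2: "s2 > 1"
    and exponents: "p ^ l2 * (s2 - 1) < p ^ l1 * (s1 - 1)"
begin

text \<open>The weights of \<open>power_diff_char\<close>: for \<open>x\<close> and \<open>y\<close>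
  with equal leading terms, the difference of the \<open>di\<close>-th powers has degree
  \<open>ei * degree x + qi * degree (x - y)\<close>.\<close>

abbreviation "q1 \<equiv> p ^ l1"
abbreviation "q2 \<equiv> p ^ l2"
abbreviation "e1 \<equiv> q1 * (s1 - 1)"
abbreviation "e2 \<equiv> q2 * (s2 - 1)"

lemma e1_add: "e1 + q1 = d1"
  using d12(1) d1(1) by (cases s1) auto

lemma e2_add: "e2 + q2 = d2"
  using s2 d2(1) by (cases s2) auto

lemma q_pos: "0 < q1" "0 < q2"
  using prime_gt_0_nat[OF prime_p] by auto

lemma q1_less_q2: "q1 < q2"
  using e1_add e2_add exponents d12(2) by linarith

lemma q2_le_e2: "q2 \<le> e2"
proof -
  have "q2 * 1 \<le> e2" using s2 by (intro mult_le_mono2) simp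
  then show ?thesis by simp
qed

lemma q2_ge2: "2 \<le> q2"
  using q1_less_q2 q_pos by linarith

lemma e1_ge2: "2 \<le> e1"
  using q2_ge2 q2_le_e2 exponents by linarith

lemma d2_ge2: "2 \<le> d2"
  using d12 by linarith

lemma l1_less_l2: "l1 < l2"
  using q1_less_q2 power_strict_increasing_iff[OF prime_gt_1_nat[OF prime_p]] by blast

text \<open>As \<open>l1 < l2\<close>, the number \<open>q1\<close> divides both exponents and so
  their positive difference.\<close>

lemma q1_le_diff: "d1 + q1 \<le> d2"
proof -
  have "q1 dvd q2" using l1_less_l2 by (simp add: le_imp_power_dvd)
  then have "q1 dvd d2 - d1" unfolding d1(1) d2(1) by (intro dvd_diff_nat) auto
  then have "q1 \<le> d2 - d1" using d12(2) by (intro dvd_imp_le) auto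
  then show ?thesis using d12(2) by linarith
qed

text \<open>At the second step \<open>degree x\<close> is \<open>d2\<close> and
  \<open>degree (x - y)\<close> is \<open>e1\<close>; the inequality says that there the upper
  monomial contributes the larger degree.\<close>

lemma first_slope: "(e1 - e2) * d2 < (q2 - q1) * e1"
  using slope_inequality[OF exponents e1_add e2_add q1_le_diff q2_le_e2 q_pos(1)] .

lemma degree_f: "degree f = d2"
  unfolding f_eq using d12 c1 c2
  by (subst degree_add_eq_right) (auto simp: degree_monom_eq absolute_unit_def)

lemma lead_coeff_f: "lead_coeff f = c2"
  unfolding degree_f using d12 by (simp add: f_eq)

text \<open>The leading coefficient is \<open>c2\<close> to the power
  \<open>1 + d2 + ... + d2 ^ (k - 1)\<close>. Later only its independence of the starting point and
  its being a unit matter, so the exponent is hidden.\<close>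

lemma orbit_poly_Suc:
  "degree (orbit_poly f \<alpha> (Suc k)) = d2 ^ k"
  "\<exists>\<kappa>. absolute_unit \<kappa> \<and> (\<forall>\<alpha>. lead_coeff (orbit_poly f \<alpha> (Suc k)) = \<kappa>)"
proof -
  have "degree (orbit_poly f \<alpha> (Suc k)) = d2 ^ k \<and>
    lead_coeff (orbit_poly f \<alpha> (Suc k)) = c2 ^ (\<Sum>i<k. d2 ^ i)" for \<alpha>
  proof (induction k)
    case 0
    then show ?case unfolding orbit_poly_one by simp
  next
    case (Suc k)
    let ?x = "orbit_poly f \<alpha> (Suc k)"
    have pos: "0 < d2 ^ k" using d12 by simp
    have d: "degree (pcompose f ?x) = d2 ^ Suc k"
      using Suc by (simp add: degree_pcompose degree_f del: orbit_poly.simps)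
    then have big: "degree [:0, 1 :: 'k:] < degree (pcompose f ?x)"
      using one_less_power[of d2 "Suc k"] d2_ge2 by simp
    have "lead_coeff (pcompose f ?x) = c2 * (c2 ^ (\<Sum>i<k. d2 ^ i)) ^ d2"
      using lead_coeff_comp[of ?x f] conjunct1[OF Suc] pos
      unfolding lead_coeff_f conjunct2[OF Suc] unfolding degree_f by (simp del: orbit_poly.simps)
    also have "\<dots> = c2 ^ (\<Sum>i<Suc k. d2 ^ i)"
      unfolding sum.lessThan_Suc_shift by (simp add: sum_distrib_left mult.commute flip: power_mult)
    finally show ?case
      using d degree_add_eq_left[OF big] lead_coeff_add_le[OF big]
      unfolding orbit_poly.simps(2)[of f \<alpha> "Suc k"] by (simp add: add.commute del: orbit_poly.simps)
  qed
  then show "degree (orbit_poly f \<alpha> (Suc k)) = d2 ^ k"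
    "\<exists>\<kappa>. absolute_unit \<kappa> \<and> (\<forall>\<alpha>. lead_coeff (orbit_poly f \<alpha> (Suc k)) = \<kappa>)"
    using absolute_unit_power[OF c2] by blast+
qed

text \<open>Each monomial of \<open>f\<close> contributes a difference computed by
  \<open>power_diff_char\<close>; the one of larger degree supplies the leading term.\<close>

lemma pcompose_f_diff:
  assumes same: "degree y = degree x" "lead_coeff y = lead_coeff x" "absolute_unit (lead_coeff x)"
    and ne: "x \<noteq> y"
  shows "e2 * degree x + q2 * degree (x - y) < e1 * degree x + q1 * degree (x - y) \<Longrightarrow>
      degree (pcompose f x - pcompose f y) = e1 * degree x + q1 * degree (x - y) \<and>
      (\<exists>u. absolute_unit u \<and> lead_coeff (pcompose f x - pcompose f y) = u * lead_coeff (x - y) ^ q1)"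
    and "e1 * degree x + q1 * degree (x - y) < e2 * degree x + q2 * degree (x - y) \<Longrightarrow>
      degree (pcompose f x - pcompose f y) = e2 * degree x + q2 * degree (x - y) \<and>
      (\<exists>u. absolute_unit u \<and> lead_coeff (pcompose f x - pcompose f y) = u * lead_coeff (x - y) ^ q2)"
proof -
  define A1 A2 where "A1 = smult c1 (x ^ d1 - y ^ d1)" and "A2 = smult c2 (x ^ d2 - y ^ d2)"
  have comp: "pcompose f z = smult c1 (z ^ d1) + smult c2 (z ^ d2)" for z
  proof -
    have "pcompose (monom 1 n) z = z ^ n" for n
      by (induction n) (simp_all add: monom_Suc pcompose_pCons pcompose_1)
    moreover have "monom c n = smult c (monom 1 n)" for c :: 'k and n
      by (simp add: smult_monom)
    ultimately show ?thesis unfolding f_eq by (metis pcompose_add pcompose_smult)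
  qed
  have diff: "pcompose f x - pcompose f y = A1 + A2"
    unfolding A1_def A2_def comp by (simp add: smult_diff_right)
  have nz: "c1 \<noteq> 0" "c2 \<noteq> 0" using c1 c2 by (auto simp: absolute_unit_def)
  note pd = power_diff_char[of y x, OF _ same(1,2) ne, unfolded char, OF prime_p]
  have deg: "degree A1 = e1 * degree x + q1 * degree (x - y)"
      "degree A2 = e2 * degree x + q2 * degree (x - y)"
    unfolding A1_def A2_def d1(1) d2(1)
    using pd(1)[OF d1(2) refl, of l1] pd(1)[OF d2(2) refl, of l2] nz by (simp_all add: algebra_simps)
  have u: "absolute_unit (c1 * (of_nat s1 * lead_coeff x ^ (s1 - 1)) ^ q1)"
      "absolute_unit (c2 * (of_nat s2 * lead_coeff x ^ (s2 - 1)) ^ q2)"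
    using c1 c2 d1(2) d2(2) same(3) prime_p
    by (auto intro!: absolute_unit_mult absolute_unit_power absolute_unit_of_nat simp: char)
  have lead: "lead_coeff A1 = c1 * (of_nat s1 * lead_coeff x ^ (s1 - 1)) ^ q1 * lead_coeff (x - y) ^ q1"
      "lead_coeff A2 = c2 * (of_nat s2 * lead_coeff x ^ (s2 - 1)) ^ q2 * lead_coeff (x - y) ^ q2"
    unfolding A1_def A2_def d1(1) d2(1)
    using pd(2)[OF d1(2) refl, of l1] pd(2)[OF d2(2) refl, of l2]
    by (simp_all add: lead_coeff_smult power_mult_distrib mult.assoc)
  show "degree (pcompose f x - pcompose f y) = e1 * degree x + q1 * degree (x - y) \<and>
      (\<exists>u. absolute_unit u \<and> lead_coeff (pcompose f x - pcompose f y) = u * lead_coeff (x - y) ^ q1)"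
    if "e2 * degree x + q2 * degree (x - y) < e1 * degree x + q1 * degree (x - y)"
  proof -
    have "degree A2 < degree A1" using that deg by simp
    then show ?thesis
      unfolding diff using degree_add_eq_left[of A2 A1] lead_coeff_add_le[of A2 A1] deg(1) lead(1) u(1)
      by (metis add.commute)
  qed
  show "degree (pcompose f x - pcompose f y) = e2 * degree x + q2 * degree (x - y) \<and>
      (\<exists>u. absolute_unit u \<and> lead_coeff (pcompose f x - pcompose f y) = u * lead_coeff (x - y) ^ q2)"
    if "e1 * degree x + q1 * degree (x - y) < e2 * degree x + q2 * degree (x - y)"
  proof -
    have "degree A1 < degree A2" using that deg by simp
    then show ?thesis
      unfolding diff using degree_add_eq_right[of A1 A2] lead_coeff_add_le[of A1 A2] deg(2) lead(2) u(2)
      by metis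
  qed
qed

text \<open>Two linear arguments differing by a constant: the exponent hypothesis
  \<open>e2 < e1\<close> lets the lower monomial win.\<close>

lemma pcompose_f_diff_linear:
  assumes "a \<noteq> b"
  defines "G \<equiv> pcompose f [:a, 1:] - pcompose f [:b, 1:]"
  shows "degree G = e1" "\<exists>u. absolute_unit u \<and> lead_coeff G = u * (a - b) ^ q1"
proof -
  let ?x = "[:a, 1:]" and ?y = "[:b, 1:]"
  have X: "degree ?x = 1" "degree ?y = 1" "lead_coeff ?x = 1" "lead_coeff ?y = 1"
    "degree (?x - ?y) = 0" "lead_coeff (?x - ?y) = a - b" by simp_all
  have "absolute_unit (lead_coeff ?x)" unfolding X(3) by (rule absolute_unit_one)
  moreover have "?x \<noteq> ?y" using assms(1) by simp
  moreover have "e2 * degree ?x + q2 * degree (?x - ?y) < e1 * degree ?x + q1 * degree (?x - ?y)"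
    unfolding X(1,5) using exponents by simp
  ultimately have *: "degree G = e1 * degree ?x + q1 * degree (?x - ?y) \<and>
      (\<exists>u. absolute_unit u \<and> lead_coeff G = u * lead_coeff (?x - ?y) ^ q1)"
    unfolding G_def
    by (intro pcompose_f_diff(1)[OF trans[OF X(2) X(1)[symmetric]] trans[OF X(4) X(3)[symmetric]]])
  show "degree G = e1" using * unfolding X(1,5) by simp
  show "\<exists>u. absolute_unit u \<and> lead_coeff G = u * (a - b) ^ q1" using * unfolding X(6) by blast
qed

definition orbit_diff :: "'k \<Rightarrow> 'k \<Rightarrow> nat \<Rightarrow> 'k poly" where
  "orbit_diff \<alpha>1 \<alpha>2 k = orbit_poly f \<alpha>1 k - orbit_poly f \<alpha>2 k"

lemma orbit_diff_one: "orbit_diff \<alpha>1 \<alpha>2 (Suc 0) = [:poly f \<alpha>1 - poly f \<alpha>2:]"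
  unfolding orbit_diff_def orbit_poly_one by simp

lemma orbit_diff_Suc:
  "orbit_diff \<alpha>1 \<alpha>2 (Suc k) = pcompose f (orbit_poly f \<alpha>1 k) - pcompose f (orbit_poly f \<alpha>2 k)"
  unfolding orbit_diff_def by simp

text \<open>The exponent hypothesis makes the lower term of \<open>f\<close> dominate in the first step and, by
  \<open>first_slope\<close>, the upper term in all later ones.\<close>

lemma orbit_diff_lead:
  assumes "poly f \<alpha>1 \<noteq> poly f \<alpha>2"
  shows "orbit_diff \<alpha>1 \<alpha>2 (Suc (Suc k)) \<noteq> 0 \<and>
    (e1 - e2) * d2 ^ Suc k < (q2 - q1) * degree (orbit_diff \<alpha>1 \<alpha>2 (Suc (Suc k))) \<and>
    (\<exists>u. absolute_unit u \<and> lead_coeff (orbit_diff \<alpha>1 \<alpha>2 (Suc (Suc k))) =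
      u * (poly f \<alpha>1 - poly f \<alpha>2) ^ (q1 * q2 ^ k))"
proof (induction k)
  case 0
  define G where "G = pcompose f [:poly f \<alpha>1, 1:] - pcompose f [:poly f \<alpha>2, 1:]"
  note G = pcompose_f_diff_linear[OF assms, folded G_def]
  have "G \<noteq> 0" using e1_ge2 unfolding G(1)[symmetric] by auto
  moreover have "(e1 - e2) * d2 ^ Suc 0 < (q2 - q1) * degree G"
    using first_slope unfolding G(1) by simp
  ultimately show ?case
    unfolding orbit_diff_Suc[of _ _ "Suc 0"] orbit_poly_one G_def[symmetric] power_0 mult_1_right using G(2) by blast
next
  case (Suc k)
  let ?C = "poly f \<alpha>1 - poly f \<alpha>2"
  let ?x = "orbit_poly f \<alpha>1 (Suc (Suc k))" and ?y = "orbit_poly f \<alpha>2 (Suc (Suc k))"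
  let ?E = "orbit_diff \<alpha>1 \<alpha>2 (Suc (Suc k))"
  define D e where "D = d2 ^ Suc k" and "e = degree ?E"
  have xy: "?x - ?y = ?E" unfolding orbit_diff_def ..
  have slope: "(e1 - e2) * D < (q2 - q1) * e" and ne: "?E \<noteq> 0"
    using Suc unfolding D_def e_def by auto
  obtain u where u: "absolute_unit u" "lead_coeff ?E = u * ?C ^ (q1 * q2 ^ k)" using Suc by blast
  have deg: "degree ?x = D" "degree ?y = D" unfolding D_def by (rule orbit_poly_Suc)+
  obtain \<kappa> where \<kappa>: "absolute_unit \<kappa>" "lead_coeff ?x = \<kappa>" "lead_coeff ?y = \<kappa>"
    using orbit_poly_Suc(2)[of "Suc k"] by blast
  have less: "e1 * D + q1 * e < e2 * D + q2 * e"
  proof -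
    obtain \<delta> w where "e1 = e2 + \<delta>" "q2 = q1 + w"
      using exponents q1_less_q2 less_imp_add_positive by metis
    then show ?thesis using slope by (simp add: algebra_simps)
  qed
  define G where "G = pcompose f ?x - pcompose f ?y"
  have G: "degree G = e2 * D + q2 * e"
      "\<exists>v. absolute_unit v \<and> lead_coeff G = v * lead_coeff ?E ^ q2"
  proof -
    have "?x \<noteq> ?y" using ne unfolding xy[symmetric] by simp
    moreover have "absolute_unit (lead_coeff ?x)" unfolding \<kappa>(2) by (rule \<kappa>(1))
    moreover have "e1 * degree ?x + q1 * degree (?x - ?y) < e2 * degree ?x + q2 * degree (?x - ?y)"
      using less unfolding deg(1) e_def xy .
    ultimately have *: "degree G = e2 * degree ?x + q2 * degree (?x - ?y) \<and>
        (\<exists>u. absolute_unit u \<and> lead_coeff G = u * lead_coeff (?x - ?y) ^ q2)"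
      unfolding G_def
      by (intro pcompose_f_diff(2)[OF trans[OF deg(2) deg(1)[symmetric]] trans[OF \<kappa>(3) \<kappa>(2)[symmetric]]])
    show "degree G = e2 * D + q2 * e" using * unfolding deg(1) e_def xy by blast
    show "\<exists>v. absolute_unit v \<and> lead_coeff G = v * lead_coeff ?E ^ q2"
      using * unfolding xy by blast
  qed
  \<comment> \<open>The slope inequality propagates. With \<open>d2 = e2 + q2\<close>, the
    \<open>q2\<close> part is the old inequality scaled, and the \<open>e2\<close> part uses
    \<open>e1 - e2 \<le> q2 - q1\<close>, a consequence of \<open>d1 < d2\<close>.\<close>
  have "(e1 - e2) * (d2 * D) < (q2 - q1) * (e2 * D + q2 * e)"
  proof -
    have "(e1 - e2) * D * q2 < (q2 - q1) * e * q2" using slope q_pos by simp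
    moreover have "(e1 - e2) * (e2 * D) \<le> (q2 - q1) * (e2 * D)"
      using e1_add e2_add d12 by (intro mult_le_mono1) linarith
    moreover have "(e1 - e2) * (d2 * D) = (e1 - e2) * (e2 * D) + (e1 - e2) * D * q2"
      unfolding e2_add[symmetric] by (simp only: distrib_left distrib_right mult_ac)
    moreover have "(q2 - q1) * (e2 * D + q2 * e) = (q2 - q1) * (e2 * D) + (q2 - q1) * e * q2"
      by (simp only: distrib_left mult_ac)
    ultimately show ?thesis by linarith
  qed
  then have slope': "(e1 - e2) * d2 ^ Suc (Suc k) < (q2 - q1) * degree G"
    unfolding G D_def by simp
  obtain v where v: "absolute_unit v" "lead_coeff G = v * lead_coeff ?E ^ q2" using G(2) by blast
  have "absolute_unit (v * u ^ q2)" using u v by (intro absolute_unit_mult absolute_unit_power)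
  moreover have "lead_coeff G = v * u ^ q2 * ?C ^ (q1 * q2 ^ Suc k)"
    unfolding v(2) u(2) by (simp add: power_mult_distrib mult_ac flip: power_mult)
  moreover have "G \<noteq> 0" using slope' by auto
  ultimately show ?case
    unfolding orbit_diff_Suc[of _ _ "Suc (Suc k)"] G_def[symmetric] using slope' by blast
qed

lemma absolute_unit_lead_coeff_orbit_diff:
  assumes "absolute_unit (poly f \<alpha>1 - poly f \<alpha>2)"
  shows "absolute_unit (lead_coeff (orbit_diff \<alpha>1 \<alpha>2 (Suc k)))"
proof (cases k)
  case 0
  then show ?thesis using assms by (simp add: orbit_diff_one)
next
  case (Suc n)
  have "poly f \<alpha>1 \<noteq> poly f \<alpha>2" using assms by (auto simp: absolute_unit_def)
  then obtain u where "absolute_unit u" "lead_coeff (orbit_diff \<alpha>1 \<alpha>2 (Suc k)) =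
      u * (poly f \<alpha>1 - poly f \<alpha>2) ^ (q1 * q2 ^ n)"
    using orbit_diff_lead unfolding Suc by blast
  then show ?thesis using assms by (metis absolute_unit_mult absolute_unit_power)
qed

end

text \<open>Both sets of exponents share the factor \<open>N = e * I = D * J\<close>. Dividing by it
  and using \<open>h + 1 \<le> g\<close>, it remains that \<open>h * (J - 1)\<close> plus a constant
  is below \<open>I - 1\<close>; since \<open>h * e < D\<close>, the gap grows with
  \<open>n\<close>, which is chosen to absorb the constant.\<close>

lemma set_discriminant_numerics:
  fixes d e h g D n :: nat
  assumes "0 < e" "h * e < D" "h < g" and n: "n = 2 * h * d * e + 2 * h * d * D + 2"
  defines "I \<equiv> D * n" and "J \<equiv> e * n"
  shows "h * (e * I * (I - 1) + 2 * d * e * (e * I)) + h * (D * J * (J - 1) + 2 * d * D * (D * J))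
    < g * (e * I * (I - 1))"
proof -
  define N where "N = e * D * n"
  have N: "e * I = N" "D * J = N" unfolding N_def I_def J_def by (simp_all add: mult_ac)
  have "0 < N" unfolding N_def using assms(1,2) n by simp
  have "h * J + n = (h * e + 1) * n" unfolding J_def by (simp add: algebra_simps)
  also have "\<dots> \<le> I" unfolding I_def using assms(2) by (intro mult_le_mono1) simp
  finally have "h * J + n \<le> I" .
  moreover have "h * (J - 1) \<le> h * J" by simp
  ultimately have "2 * h * d * e + h * (J - 1) + 2 * h * d * D < I - 1" unfolding n by linarith
  then have *: "N * (2 * h * d * e + h * (J - 1) + 2 * h * d * D) < N * (I - 1)" using \<open>0 < N\<close> by simp
  have "h * (N * (I - 1) + 2 * d * e * N) + h * (N * (J - 1) + 2 * d * D * N) =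
      h * (N * (I - 1)) + N * (2 * h * d * e + h * (J - 1) + 2 * h * d * D)"
    by (simp add: distrib_left mult_ac)
  also have "\<dots> < h * (N * (I - 1)) + N * (I - 1)" using * by simp
  also have "\<dots> = (h + 1) * (N * (I - 1))" by simp
  also have "\<dots> \<le> g * (N * (I - 1))" using assms(3) by (intro mult_le_mono1) simp
  finally show ?thesis unfolding N .
qed

section \<open>Escape of orbits at a fixed valuation\<close>

locale binomial_valuation = binomial_family p f c1 c2 d1 d2 l1 l2 s1 s2 + valuation_ring V
  for p and f :: "'k::alg_closed_field poly" and c1 c2 d1 d2 l1 l2 s1 s2 and V :: "'k set"
begin

lemma coeff_f_mem: "coeff f i \<in> V"
  unfolding f_eq by (intro coeff_add_closed coeff_monom_closed absolute_unit_mem c1 c2)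

lemma f_vle: "1 \<preceq> B \<Longrightarrow> x \<preceq> B \<Longrightarrow> poly f x \<preceq> B ^ d2"
  by (rule poly_vle) (auto simp: coeff_f_mem degree_f)

lemma f_vge: "1 \<prec> x \<Longrightarrow> x ^ d2 \<preceq> poly f x"
  using power_degree_vle_poly[of f x] absolute_unit_ge[OF c2]
  unfolding lead_coeff_f unfolding degree_f by (simp add: coeff_f_mem)

text \<open>The upper monomial dominates both the lower one and the parameter, and this persists
  because the iterates never become smaller than \<open>x\<close>.\<close>

lemma iterate_escape:
  assumes "1 \<prec> x" "\<mu> \<prec> x ^ d2"
  shows "x ^ (d2 ^ n) \<preceq> (shifted f \<mu> ^^ n) x"
proof (induction n)
  case (Suc n)
  let ?y = "(shifted f \<mu> ^^ n) x"
  have "x \<preceq> x ^ (d2 ^ n)" using vless_imp_vle[OF assms(1)] d12 by (intro vle_self_power) auto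
  then have xy: "x \<preceq> ?y" using Suc vle_trans by blast
  then have y: "1 \<prec> ?y" using assms(1) vle_trans by blast
  have "x ^ d2 \<preceq> ?y ^ d2" by (rule vle_power[OF xy])
  also have "\<dots> \<preceq> poly f ?y" by (rule f_vge[OF y])
  finally have "\<mu> \<prec> poly f ?y" using assms(2) vle_trans by blast
  then have "poly f ?y \<preceq> shifted f \<mu> ?y"
    unfolding shifted_def using dominant_add by (metis add.commute)
  moreover have "x ^ (d2 ^ Suc n) \<preceq> ?y ^ d2"
    using vle_power[OF Suc, of d2] by (simp add: mult.commute flip: power_mult)
  ultimately have "x ^ (d2 ^ Suc n) \<preceq> shifted f \<mu> ?y" using f_vge[OF y] vle_trans by blast
  then show ?case by simp
qed simp

text \<open>An orbit outside the disc of \<open>B\<close> escapes too fast to end at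
  \<open>\<beta>\<close>. The number \<open>j\<close> is a slack: a larger \<open>\<beta>\<close> is
  tolerated at the price of losing control over the last \<open>j\<close> steps.\<close>

lemma orbit_vle:
  assumes B: "1 \<preceq> B" "\<alpha> \<preceq> B" "\<beta> \<preceq> B ^ (d2 ^ j)"
    and m: "(shifted f \<mu> ^^ m) \<alpha> = \<beta>" "0 < m" "j \<le> m"
  shows "\<mu> \<preceq> B ^ d2" and "k + j \<le> m \<Longrightarrow> (shifted f \<mu> ^^ k) \<alpha> \<preceq> B"
proof -
  have le: "\<beta> \<preceq> B ^ (d2 ^ i)" if "j \<le> i" for i
  proof -
    have "d2 ^ j \<le> d2 ^ i" using that d12 by (intro power_increasing) auto
    then show ?thesis using B(3) vle_power_mono[OF B(1)] vle_trans by blast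
  qed
  show \<mu>: "\<mu> \<preceq> B ^ d2"
  proof (rule ccontr)
    assume big: "B ^ d2 \<prec> \<mu>"
    obtain n where n: "m = Suc n" using m(2) gr0_implies_Suc by blast
    \<comment> \<open>For a parameter this large the first iterate is already as large as
      \<open>\<mu>\<close>, and the orbit escapes from there.\<close>
    let ?x = "shifted f \<mu> \<alpha>"
    have "poly f \<alpha> \<prec> \<mu>" using f_vle[OF B(1,2)] big vle_trans by blast
    then have \<mu>x: "\<mu> \<preceq> ?x" unfolding shifted_def by (rule dominant_add)
    have "1 \<prec> \<mu>" using one_vle_power[OF B(1)] big vle_trans by blast
    then have x: "1 \<prec> ?x" using \<mu>x vle_trans by blast
    then have "?x \<prec> ?x ^ d2" using vless_power_strict_mono[of ?x 1 d2] d12 by simp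
    then have "\<mu> \<prec> ?x ^ d2" using \<mu>x vle_trans by blast
    then have "?x ^ (d2 ^ n) \<preceq> \<beta>"
      using iterate_escape[OF x, of \<mu> n] m(1) unfolding n by (simp add: funpow_swap1)
    moreover have "\<mu> ^ (d2 ^ n) \<preceq> ?x ^ (d2 ^ n)" by (rule vle_power[OF \<mu>x])
    moreover have "\<beta> \<preceq> (B ^ d2) ^ (d2 ^ n)"
      using le[OF m(3)] unfolding n by (simp flip: power_mult)
    ultimately have "\<mu> ^ (d2 ^ n) \<preceq> (B ^ d2) ^ (d2 ^ n)" using vle_trans by blast
    then show False using big vle_power_iff d12 by simp
  qed
  show "(shifted f \<mu> ^^ k) \<alpha> \<preceq> B" if k: "k + j \<le> m"
  proof (rule ccontr)
    let ?x = "(shifted f \<mu> ^^ k) \<alpha>"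
    assume big: "B \<prec> ?x"
    then have x: "1 \<prec> ?x" using B(1) vle_trans by blast
    have "B ^ d2 \<prec> ?x ^ d2" using big d12 by (intro vless_power) auto
    then have "\<mu> \<prec> ?x ^ d2" using \<mu> vle_trans by blast
    then have "?x ^ (d2 ^ (m - k)) \<preceq> (shifted f \<mu> ^^ (m - k)) ?x" by (rule iterate_escape[OF x])
    also have "\<dots> = \<beta>" using m(1) k by (simp flip: funpow_add comp_apply[of "shifted f \<mu> ^^ (m - k)"])
    also have "\<beta> \<preceq> B ^ (d2 ^ (m - k))" using k by (intro le) simp
    finally show False using big vle_power_iff d12 by simp
  qed
qed

end

section \<open>Late collisions and bounds for their discriminants\<close>

definition late_collisions :: "'k::field poly \<Rightarrow> 'k \<Rightarrow> 'k \<Rightarrow> 'k \<Rightarrow> nat \<Rightarrow> 'k set" where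
  "late_collisions f \<alpha>1 \<alpha>2 \<beta> K =
     {\<mu>. \<exists>m n. K \<le> m \<and> K \<le> n \<and> (shifted f \<mu> ^^ m) \<alpha>1 = \<beta> \<and> (shifted f \<mu> ^^ n) \<alpha>2 = \<beta>}"

context binomial_family
begin

lemma finite_orbit_hits: "0 < m \<Longrightarrow> finite {\<mu>. (shifted f \<mu> ^^ m) \<alpha> = \<beta>}"
proof -
  assume "0 < m"
  then obtain k where k: "m = Suc k" using gr0_implies_Suc by blast
  let ?P = "orbit_poly f \<alpha> m - [:\<beta>:]"
  have "orbit_poly f \<alpha> m \<noteq> [:\<beta>:]"
    using orbit_poly_Suc(1)[of \<alpha> k] d12 unfolding k[symmetric] by (cases "\<beta> = 0") auto
  then have "finite {\<mu>. poly ?P \<mu> = 0}" by (intro poly_roots_finite) simp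
  then show ?thesis by (simp add: poly_orbit_poly)
qed

text \<open>Each hitting time below \<open>K\<close> accounts for finitely many parameters
  only.\<close>

lemma infinite_late_collisions:
  assumes "infinite (C_set f \<alpha>1 \<alpha>2 \<beta>)"
  shows "infinite (late_collisions f \<alpha>1 \<alpha>2 \<beta> K)"
proof
  assume "finite (late_collisions f \<alpha>1 \<alpha>2 \<beta> K)"
  moreover have "finite (\<Union>m\<in>{0<..<K}. {\<mu>. (shifted f \<mu> ^^ m) \<alpha> = \<beta>})" for \<alpha>
    using finite_orbit_hits by auto
  moreover have "C_set f \<alpha>1 \<alpha>2 \<beta> \<subseteq> late_collisions f \<alpha>1 \<alpha>2 \<beta> K \<union>
      (\<Union>m\<in>{0<..<K}. {\<mu>. (shifted f \<mu> ^^ m) \<alpha>1 = \<beta>}) \<union> (\<Union>m\<in>{0<..<K}. {\<mu>. (shifted f \<mu> ^^ m) \<alpha>2 = \<beta>})"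
  proof
    fix \<mu> assume "\<mu> \<in> C_set f \<alpha>1 \<alpha>2 \<beta>"
    then obtain m n where "0 < m" "0 < n" "(shifted f \<mu> ^^ m) \<alpha>1 = \<beta>" "(shifted f \<mu> ^^ n) \<alpha>2 = \<beta>"
      unfolding C_set_def by blast
    then show "\<mu> \<in> late_collisions f \<alpha>1 \<alpha>2 \<beta> K \<union>
      (\<Union>m\<in>{0<..<K}. {\<mu>. (shifted f \<mu> ^^ m) \<alpha>1 = \<beta>}) \<union> (\<Union>m\<in>{0<..<K}. {\<mu>. (shifted f \<mu> ^^ m) \<alpha>2 = \<beta>})"
      unfolding late_collisions_def by (cases "K \<le> m"; cases "K \<le> n") auto
  qed
  ultimately show False using assms by (meson finite_UnI finite_subset)
qed

end

context binomial_valuation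
begin

lemma late_collision_vle:
  assumes "\<mu> \<in> late_collisions f \<alpha>1 \<alpha>2 \<beta> K" "0 < K" "k \<le> K"
    and "1 \<preceq> B" "\<alpha>1 \<preceq> B" "\<alpha>2 \<preceq> B" "\<beta> \<preceq> B"
  shows "\<mu> \<preceq> B ^ d2" "poly (orbit_poly f \<alpha>1 k) \<mu> \<preceq> B" "poly (orbit_poly f \<alpha>2 k) \<mu> \<preceq> B"
proof -
  obtain m n where "K \<le> m" "K \<le> n" "(shifted f \<mu> ^^ m) \<alpha>1 = \<beta>" "(shifted f \<mu> ^^ n) \<alpha>2 = \<beta>"
    using assms(1) unfolding late_collisions_def by blast
  then show "\<mu> \<preceq> B ^ d2" "poly (orbit_poly f \<alpha>1 k) \<mu> \<preceq> B" "poly (orbit_poly f \<alpha>2 k) \<mu> \<preceq> B"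
    using assms orbit_vle(1)[of B \<alpha>1 \<beta> 0 m \<mu>]
      orbit_vle(2)[of B \<alpha>1 \<beta> 0 m \<mu> k] orbit_vle(2)[of B \<alpha>2 \<beta> 0 n \<mu> k]
    by (auto simp: poly_orbit_poly)
qed

text \<open>Here \<open>Q\<close> is an orbit polynomial, whose leading coefficient is a unit; the
  bound has the same form at every place.\<close>

lemma discriminant_vle_orbit:
  assumes T: "finite T" "T \<subseteq> late_collisions f \<alpha>1 \<alpha>2 \<beta> K" "Suc j \<le> K" "card T = d2 ^ j * J"
    and B: "1 \<preceq> B" "\<alpha>1 \<preceq> B" "\<alpha>2 \<preceq> B" "\<beta> \<preceq> B"
  shows "set_discriminant T \<preceq> B ^ (d2 ^ j * J * (J - 1) + 2 * d2 * d2 ^ j * (d2 ^ j * J))"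
proof -
  let ?Q = "orbit_poly f \<alpha>1 (Suc j)" and ?Y = "d2 ^ j * J * (J - 1)"
  have Q: "degree ?Q = d2 ^ j" by (rule orbit_poly_Suc)
  obtain \<kappa> where \<kappa>: "absolute_unit \<kappa>" "lead_coeff ?Q = \<kappa>" using orbit_poly_Suc(2) by blast
  have "set_discriminant T * lead_coeff ?Q ^ ?Y \<preceq> B ^ (?Y + 2 * d2 * d2 ^ j * (d2 ^ j * J))"
    unfolding Q[symmetric] using T(2,3) B d12 Q
    by (intro set_discriminant_vle_power T late_collision_vle(1)[of _ \<alpha>1 \<alpha>2 \<beta> K]
        late_collision_vle(2)[of _ \<alpha>1 \<alpha>2 \<beta> K]) (auto simp: T(4) simp del: orbit_poly.simps)
  moreover have "set_discriminant T * 1 \<preceq> set_discriminant T * lead_coeff ?Q ^ ?Y"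
    unfolding \<kappa>(2) by (intro vle_mult one_vle_power absolute_unit_ge \<kappa>) simp
  ultimately show ?thesis unfolding mult_1_right using vle_trans by blast
qed

text \<open>Here \<open>Q\<close> is an orbit difference. Its leading coefficient carries a high
  power of \<open>f(\<alpha>1) - f(\<alpha>2)\<close>, which is the gain at the poles of that
  element.\<close>

lemma discriminant_vle_orbit_diff:
  assumes T: "finite T" "T \<subseteq> late_collisions f \<alpha>1 \<alpha>2 \<beta> K" "Suc (Suc k) \<le> K" "card T = e * I"
    and B: "1 \<preceq> B" "\<alpha>1 \<preceq> B" "\<alpha>2 \<preceq> B" "\<beta> \<preceq> B"
    and ne: "poly f \<alpha>1 \<noteq> poly f \<alpha>2" and e: "e = degree (orbit_diff \<alpha>1 \<alpha>2 (Suc (Suc k)))"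
  shows "set_discriminant T * (poly f \<alpha>1 - poly f \<alpha>2) ^ (q1 * q2 ^ k * (e * I * (I - 1)))
    \<preceq> B ^ (e * I * (I - 1) + 2 * d2 * e * (e * I))"
proof -
  let ?Q = "orbit_diff \<alpha>1 \<alpha>2 (Suc (Suc k))" and ?Y = "e * I * (I - 1)"
    and ?C = "poly f \<alpha>1 - poly f \<alpha>2"
  have "0 < degree ?Q" using orbit_diff_lead[OF ne, of k] by (cases "degree ?Q") auto
  moreover have "poly ?Q \<mu> \<preceq> B" if "\<mu> \<in> T" for \<mu>
    unfolding orbit_diff_def poly_diff using that T(2,3) B
    by (intro vle_diff late_collision_vle(2,3)[of \<mu> \<alpha>1 \<alpha>2 \<beta> K]) auto
  moreover have "\<mu> \<preceq> B ^ d2" if "\<mu> \<in> T" for \<mu>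
    using that T(2,3) B by (intro late_collision_vle(1)[of \<mu> \<alpha>1 \<alpha>2 \<beta> K]) auto
  ultimately have *: "set_discriminant T * lead_coeff ?Q ^ ?Y \<preceq> B ^ (?Y + 2 * d2 * e * (e * I))"
    unfolding e using T(1) T(4)[unfolded e] B(1) by (intro set_discriminant_vle_power) auto
  obtain u where u: "absolute_unit u" "lead_coeff ?Q = u * ?C ^ (q1 * q2 ^ k)"
    using orbit_diff_lead[OF ne, of k] by blast
  have "set_discriminant T * ?C ^ (q1 * q2 ^ k * ?Y) * 1 \<preceq> set_discriminant T * ?C ^ (q1 * q2 ^ k * ?Y) * u ^ ?Y"
    by (rule vle_mult[OF vle_refl one_vle_power[OF absolute_unit_ge[OF u(1)]]])
  also have "\<dots> = set_discriminant T * lead_coeff ?Q ^ ?Y"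
    unfolding u(2) power_mult_distrib power_mult[symmetric] by (simp only: mult_ac)
  also note *
  finally show ?thesis by simp
qed

end

section \<open>Many collisions force \<open>f(\<alpha>1) = f(\<alpha>2)\<close>\<close>

context binomial_family
begin

lemma binomial_valuation_intro: "valuation_ring V \<Longrightarrow> binomial_valuation p f c1 c2 d1 d2 l1 l2 s1 s2 V"
  by (simp add: binomial_valuation_def binomial_family_axioms)

lemma difference_algebraic:
  assumes inf: "infinite (C_set f \<alpha>1 \<alpha>2 \<beta>)"
  shows "algebraic_over (range of_int) (poly f \<alpha>1 - poly f \<alpha>2)"
proof (rule ccontr)
  define C where "C = poly f \<alpha>1 - poly f \<alpha>2"
  assume "\<not> algebraic_over (range of_int) (poly f \<alpha>1 - poly f \<alpha>2)"
  then have C0: "\<not> algebraic_over (range of_int) C" by (simp add: C_def)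
  obtain F where F: "unital_subring F" "range of_int \<subseteq> F" "\<forall>y\<in>F. inverse y \<in> F"
    and C: "\<not> algebraic_over F C" and alg: "\<forall>x. algebraic_over (adjoin F C) x"
    using exists_field_of_constants[OF unital_subring_range_of_int C0] .
  interpret F: unital_subring F by fact
  have "C \<noteq> 0" using C F.algebraic_over_mem[OF F.zero_closed] by auto
  then have ne: "poly f \<alpha>1 \<noteq> poly f \<alpha>2" unfolding C_def by simp

  obtain z1 h1 where z1: "z1 \<noteq> 0"
    "\<forall>V. valuation_ring V \<and> F \<subseteq> V \<and> C \<in> V \<longrightarrow> z1 \<in> V \<and> \<alpha>1 * z1 \<in> V"
    "\<forall>V. valuation_ring V \<and> F \<subseteq> V \<and> C \<notin> V \<longrightarrow>
      valuation_ring.vle V z1 (C ^ h1) \<and> valuation_ring.vle V \<alpha>1 (C ^ h1)"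
    using uniform_pole_bound[OF F(3) C spec[OF alg, of \<alpha>1]] .
  obtain z2 h2 where z2: "z2 \<noteq> 0"
    "\<forall>V. valuation_ring V \<and> F \<subseteq> V \<and> C \<in> V \<longrightarrow> z2 \<in> V \<and> \<alpha>2 * z2 \<in> V"
    "\<forall>V. valuation_ring V \<and> F \<subseteq> V \<and> C \<notin> V \<longrightarrow>
      valuation_ring.vle V z2 (C ^ h2) \<and> valuation_ring.vle V \<alpha>2 (C ^ h2)"
    using uniform_pole_bound[OF F(3) C spec[OF alg, of \<alpha>2]] .
  obtain z3 h3 where z3: "z3 \<noteq> 0"
    "\<forall>V. valuation_ring V \<and> F \<subseteq> V \<and> C \<in> V \<longrightarrow> z3 \<in> V \<and> \<beta> * z3 \<in> V"
    "\<forall>V. valuation_ring V \<and> F \<subseteq> V \<and> C \<notin> V \<longrightarrow>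
      valuation_ring.vle V z3 (C ^ h3) \<and> valuation_ring.vle V \<beta> (C ^ h3)"
    using uniform_pole_bound[OF F(3) C spec[OF alg, of \<beta>]] .
  \<comment> \<open>A common denominator of the three points where \<open>C\<close> is integral, and
    one exponent that serves all of them at the poles of \<open>C\<close>.\<close>
  define z h where "z = z1 * z2 * z3" and "h = h1 + h2 + h3"
  have z: "z \<noteq> 0" using z1 z2 z3 by (simp add: z_def)

  \<comment> \<open>\<open>g\<close> is the exponent of \<open>C\<close> in the leading coefficient
    of the orbit difference at index \<open>h + 2\<close>; this index is large enough to give
    \<open>h < g\<close>.\<close>
  define g e where "g = q1 * q2 ^ h" and "e = degree (orbit_diff \<alpha>1 \<alpha>2 (Suc (Suc h)))"
  have "h < 2 ^ h" by (rule less_exp)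
  also have "\<dots> \<le> q2 ^ h" using q2_ge2 by (rule power_mono) simp
  also have "\<dots> \<le> g"
    unfolding g_def using mult_le_mono1[of 1 q1 "q2 ^ h"] q_pos(1) by linarith
  finally have "h < g" .
  have "0 < e" using orbit_diff_lead[OF ne, of h] unfolding e_def by (cases "degree (orbit_diff \<alpha>1 \<alpha>2 (Suc (Suc h)))") auto
  \<comment> \<open>Chosen so that \<open>D\<close>, the degree of the orbit polynomial at index
    \<open>j + 1\<close>, exceeds \<open>h * e\<close>.\<close>
  define j where "j = h * e"
  define D where "D = d2 ^ j"
  have "h * e < 2 ^ j" unfolding j_def by (rule less_exp)
  also have "\<dots> \<le> D" unfolding D_def using d2_ge2 by (rule power_mono) simp
  finally have "h * e < D" .
  \<comment> \<open>\<open>e * I = D * J\<close>, so one set \<open>T\<close> fits both determinant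
    estimates.\<close>
  define n I J where "n = 2 * h * d2 * e + 2 * h * d2 * D + 2" and "I = D * n" and "J = e * n"
  define Y X where "Y = e * I * (I - 1)" and "X = D * J * (J - 1) + 2 * d2 * D * (D * J)"
  have num: "h * (Y + 2 * d2 * e * (e * I)) + h * X < g * Y"
    unfolding X_def Y_def I_def J_def
    by (rule set_discriminant_numerics[OF \<open>0 < e\<close> \<open>h * e < D\<close> \<open>h < g\<close> n_def])

  define K where "K = Suc (Suc h) + Suc j"
  obtain T where T: "finite T" "card T = e * I" "T \<subseteq> late_collisions f \<alpha>1 \<alpha>2 \<beta> K"
    using infinite_arbitrarily_large[OF infinite_late_collisions[OF inf]] by metis
  then have T': "card T = d2 ^ j * J" unfolding I_def J_def D_def by (simp add: mult_ac)
  \<comment> \<open>The factor \<open>z ^ X\<close> clears the poles that the first estimate permits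
    where \<open>C\<close> is integral.\<close>
  define W where "W = set_discriminant T * z ^ X"
  have "W \<noteq> 0" unfolding W_def using set_discriminant_nonzero[OF T(1)] z by simp

  have finite_place: "W \<in> V" if V: "valuation_ring V" "F \<subseteq> V" "C \<in> V" for V
  proof -
    interpret binomial_valuation p f c1 c2 d1 d2 l1 l2 s1 s2 V
      using V(1) by (rule binomial_valuation_intro)
    have Z: "z1 \<in> V \<and> \<alpha>1 * z1 \<in> V" "z2 \<in> V \<and> \<alpha>2 * z2 \<in> V" "z3 \<in> V \<and> \<beta> * z3 \<in> V"
      using z1(2) z2(2) z3(2) V by blast+
    have "z \<in> V" unfolding z_def using Z by (intro mult_closed) auto
    have bound: "vle x (inverse z)" if "x * z \<in> V" for x
    proof -
      have "x = x * z * inverse z" using z by simp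
      then show ?thesis unfolding vle_def using that by blast
    qed
    have "(\<alpha>1 * z1) * z2 * z3 \<in> V" "z1 * (\<alpha>2 * z2) * z3 \<in> V" "z1 * z2 * (\<beta> * z3) \<in> V"
      using Z by (auto intro!: mult_closed[of _ z3] mult_closed[of z1] mult_closed[of "z1 * z2"] mult_closed[of _ z2])
    then have poles: "\<alpha>1 * z \<in> V" "\<alpha>2 * z \<in> V" "\<beta> * z \<in> V"
      by (simp_all add: z_def mult_ac)
    have "vle (set_discriminant T) (inverse z ^ X)"
      unfolding X_def D_def
    proof (rule discriminant_vle_orbit[OF T(1,3) _ T'])
      show "vle 1 (inverse z)" using z \<open>z \<in> V\<close> by (rule one_vle_inverse)
      show "vle \<alpha>1 (inverse z)" "vle \<alpha>2 (inverse z)" "vle \<beta> (inverse z)"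
        by (intro bound poles)+
    qed (simp add: K_def)
    then have "vle W (inverse z ^ X * z ^ X)" unfolding W_def by (intro vle_mult vle_refl)
    then show "W \<in> V" using z by (simp add: vle_one_iff flip: power_mult_distrib)
  qed
  have infinite_place: "W \<in> V \<and> inverse W \<notin> V" if V: "valuation_ring V" "F \<subseteq> V" "C \<notin> V" for V
  proof -
    interpret binomial_valuation p f c1 c2 d1 d2 l1 l2 s1 s2 V
      using V(1) by (rule binomial_valuation_intro)
    have Z: "vle z1 (C ^ h1) \<and> vle \<alpha>1 (C ^ h1)" "vle z2 (C ^ h2) \<and> vle \<alpha>2 (C ^ h2)"
        "vle z3 (C ^ h3) \<and> vle \<beta> (C ^ h3)"
      using z1(3) z2(3) z3(3) V by blast+
    have C1: "\<not> vle C 1" using V(3) by (simp add: vle_one_iff)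
    then have C1': "vle 1 C" by (rule vless_imp_vle)
    have up: "vle x (C ^ h)" if "vle x (C ^ i)" "i \<le> h" for x i
      using that vle_power_mono[OF C1'] vle_trans by blast
    have "vle (set_discriminant T * C ^ (g * Y)) ((C ^ h) ^ (Y + 2 * d2 * e * (e * I)))"
      unfolding g_def Y_def C_def
    proof (rule discriminant_vle_orbit_diff[OF T(1,3) _ T(2) _ _ _ _ ne e_def], fold C_def)
      show "vle 1 (C ^ h)" by (rule one_vle_power[OF C1'])
      show "vle \<alpha>1 (C ^ h)" "vle \<alpha>2 (C ^ h)" "vle \<beta> (C ^ h)"
        using Z up[of \<alpha>1 h1] up[of \<alpha>2 h2] up[of \<beta> h3] by (simp_all add: h_def)
    qed (simp add: K_def)
    moreover have "vle z (C ^ h)"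
      unfolding z_def h_def power_add using Z by (intro vle_mult) auto
    then have "vle (z ^ X) ((C ^ h) ^ X)" by (rule vle_power)
    ultimately have "vle (set_discriminant T * C ^ (g * Y) * z ^ X)
        ((C ^ h) ^ (Y + 2 * d2 * e * (e * I)) * (C ^ h) ^ X)" by (rule vle_mult)
    also have "(C ^ h) ^ (Y + 2 * d2 * e * (e * I)) * (C ^ h) ^ X =
        C ^ (h * (Y + 2 * d2 * e * (e * I)) + h * X)"
      by (simp only: power_add power_mult)
    finally have "vle (W * C ^ (g * Y)) (C ^ (h * (Y + 2 * d2 * e * (e * I)) + h * X))"
      unfolding W_def by (simp add: mult_ac)
    \<comment> \<open>By \<open>num\<close>, the gain \<open>g * Y\<close> exceeds everything lost
      to \<open>z\<close>, to the starting points and to the target.\<close>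
    then have less: "\<not> vle (C ^ (g * Y)) (W * C ^ (g * Y))"
      using vless_power_strict_mono[OF C1 num] vle_trans by blast
    have "\<not> vle 1 W"
    proof
      assume "vle 1 W"
      then have "vle (1 * C ^ (g * Y)) (W * C ^ (g * Y))" by (intro vle_mult vle_refl)
      then show False using less by simp
    qed
    then show ?thesis
      using vless_imp_vle[of 1 W] one_vle_inverse[of "inverse W"] \<open>W \<noteq> 0\<close> by (auto simp: vle_one_iff)
  qed
  obtain V where V: "valuation_ring V" "F \<subseteq> V" "C \<notin> V" using exists_valuation_ring[OF F(1) C] .
  \<comment> \<open>An element integral at all places over \<open>F\<close> is algebraic over
    \<open>F\<close>. Then so is its inverse, which must therefore be integral at a pole of
    \<open>C\<close> as well.\<close>
  have "algebraic_over F W"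
  proof (rule ccontr)
    assume "\<not> algebraic_over F W"
    then obtain V' where "valuation_ring V'" "F \<subseteq> V'" "W \<notin> V'" using exists_valuation_ring[OF F(1)] by blast
    then show False using finite_place infinite_place by blast
  qed
  then have "inverse W \<in> V"
    using valuation_ring.algebraic_over_imp_mem[OF V(1) algebraic_over_inverse V(2)] F(3) by blast
  then show False using infinite_place[OF V] by blast
qed

text \<open>At a pole of \<open>\<alpha>1\<close> the first two iterates of both points are bounded
  by \<open>\<alpha>1\<close>. The first iterate \<open>x\<close> has exactly this size, but the
  second iterates differ by an amount of size \<open>x ^ e1\<close>, and
  \<open>e1 \<ge> 2\<close>.\<close>

lemma transcendental_start_contradiction:
  assumes inf: "infinite (C_set f \<alpha>1 \<alpha>2 \<beta>)"
    and C: "absolute_unit (poly f \<alpha>1 - poly f \<alpha>2)" and "\<not> algebraic_over (range of_int) \<alpha>1"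
  shows False
proof -
  let ?C = "poly f \<alpha>1 - poly f \<alpha>2"
  obtain F where F: "unital_subring F" "range of_int \<subseteq> F" "\<forall>y\<in>F. inverse y \<in> F"
    and \<alpha>: "\<not> algebraic_over F \<alpha>1" and alg: "\<forall>x. algebraic_over (adjoin F \<alpha>1) x"
    using exists_field_of_constants[OF unital_subring_range_of_int assms(3)] .
  obtain z h where "z \<noteq> 0"
    "\<forall>V. valuation_ring V \<and> F \<subseteq> V \<and> \<alpha>1 \<in> V \<longrightarrow> z \<in> V \<and> \<beta> * z \<in> V"
    and h: "\<forall>V. valuation_ring V \<and> F \<subseteq> V \<and> \<alpha>1 \<notin> V \<longrightarrow>
      valuation_ring.vle V z (\<alpha>1 ^ h) \<and> valuation_ring.vle V \<beta> (\<alpha>1 ^ h)"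
    using uniform_pole_bound[OF F(3) \<alpha> spec[OF alg, of \<beta>]] .
  obtain V where V: "valuation_ring V" "F \<subseteq> V" "\<alpha>1 \<notin> V" using exists_valuation_ring[OF F(1) \<alpha>] .
  interpret binomial_valuation p f c1 c2 d1 d2 l1 l2 s1 s2 V
    using V(1) by (rule binomial_valuation_intro)
  have a1: "\<not> vle \<alpha>1 1" using V(3) by (simp add: vle_one_iff)
  then have a1': "vle 1 \<alpha>1" by (rule vless_imp_vle)
  have a1d: "\<not> vle (\<alpha>1 ^ d2) \<alpha>1" "\<not> vle (\<alpha>1 ^ d2) 1"
    using vless_power_strict_mono[OF a1, of 1 d2] vless_power_strict_mono[OF a1, of 0 d2] d12 by simp_all
  have a2: "vle \<alpha>2 \<alpha>1"
  proof (rule ccontr)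
    assume *: "\<not> vle \<alpha>2 \<alpha>1"
    then have "\<not> vle \<alpha>2 1" using a1' vle_trans by blast
    then have "vle (\<alpha>2 ^ d2) (poly f \<alpha>2)" by (rule f_vge)
    also have "poly f \<alpha>2 = poly f \<alpha>1 - ?C" by simp
    also have "vle \<dots> (\<alpha>1 ^ d2)"
    proof (rule vle_diff)
      show "vle (poly f \<alpha>1) (\<alpha>1 ^ d2)" by (rule f_vle[OF a1' vle_refl])
      have "vle ?C 1" using absolute_unit_mem[OF C] by (simp add: vle_one_iff)
      then show "vle ?C (\<alpha>1 ^ d2)" using one_vle_power[OF a1'] vle_trans by blast
    qed
    finally show False using * vle_power_iff d12 by simp
  qed
  \<comment> \<open>This brings the bound \<open>\<alpha>1 ^ h\<close> for \<open>\<beta>\<close>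
    into the form required by \<open>orbit_vle\<close> with slack \<open>h\<close>; the two further
    steps in \<open>h + 2\<close> cover the first two iterates.\<close>
  have "h \<le> 2 ^ h" by (simp add: less_imp_le)
  also have "\<dots> \<le> d2 ^ h" using d2_ge2 by (rule power_mono) simp
  finally have \<beta>: "vle \<beta> (\<alpha>1 ^ (d2 ^ h))"
    using h V vle_power_mono[OF a1'] vle_trans by blast
  obtain \<mu> where "\<mu> \<in> late_collisions f \<alpha>1 \<alpha>2 \<beta> (h + 2)"
    using infinite_late_collisions[OF inf] infinite_imp_nonempty by blast
  then obtain m n where mn: "h + 2 \<le> m" "h + 2 \<le> n"
      "(shifted f \<mu> ^^ m) \<alpha>1 = \<beta>" "(shifted f \<mu> ^^ n) \<alpha>2 = \<beta>"
    unfolding late_collisions_def by blast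
  define x y where "x = shifted f \<mu> \<alpha>1" and "y = shifted f \<mu> \<alpha>2"
  have x: "vle x \<alpha>1" "vle (shifted f \<mu> x) \<alpha>1"
    using orbit_vle(2)[OF a1' vle_refl \<beta> mn(3), of 1] orbit_vle(2)[OF a1' vle_refl \<beta> mn(3), of 2] mn(1)
    by (simp_all add: x_def numeral_2_eq_2)
  have y: "vle (shifted f \<mu> y) \<alpha>1"
    using orbit_vle(2)[OF a1' a2 \<beta> mn(4), of 2] mn(2) by (simp add: y_def numeral_2_eq_2)
  \<comment> \<open>If \<open>x\<close> were smaller, then \<open>f(\<alpha>1) = x - \<mu>\<close>,
    rewritten as \<open>f(x) + x\<close> minus the second iterate, would be too small.\<close>
  have "vle \<alpha>1 x"
  proof (rule ccontr)
    assume *: "\<not> vle \<alpha>1 x"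
    have "\<not> vle (\<alpha>1 ^ d2) (poly f x)"
    proof (cases "vle x 1")
      case True
      then have "vle (poly f x) 1" using f_vle[of 1 x] by simp
      then show ?thesis using a1d(2) vle_trans by blast
    next
      case False
      then have "vle (poly f x) (x ^ d2)" using f_vle[OF vless_imp_vle vle_refl] by blast
      then show ?thesis using vless_power[OF *, of d2] d12 vle_trans by auto
    qed
    moreover have "\<not> vle (\<alpha>1 ^ d2) x" using x(1) a1d(1) vle_trans by blast
    moreover have "\<not> vle (\<alpha>1 ^ d2) (- shifted f \<mu> x)"
      using x(2) a1d(1) vle_trans unfolding vle_uminus_iff by blast
    ultimately have "\<not> vle (\<alpha>1 ^ d2) (poly f x + x + - shifted f \<mu> x)" by (intro vless_add)
    moreover have "poly f x + x + - shifted f \<mu> x = poly f \<alpha>1"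
      by (simp add: x_def shifted_def)
    ultimately show False using f_vge[OF a1] by simp
  qed
  then have x1: "\<not> vle x 1" using a1 vle_trans by blast
  \<comment> \<open>Since \<open>y = x - ?C\<close>, the difference of the second iterates is
    \<open>G\<close> evaluated at \<open>x\<close>.\<close>
  define G where "G = pcompose f [:0, 1:] - pcompose f [:- ?C, 1:]"
  have "?C \<noteq> 0" using C by (simp add: absolute_unit_def)
  note G = pcompose_f_diff_linear[of 0 "- ?C", folded G_def]
  have deg: "degree G = e1" using \<open>?C \<noteq> 0\<close> by (intro G) simp
  obtain u where u: "absolute_unit u" "lead_coeff G = u * (0 - - ?C) ^ q1" using G(2) \<open>?C \<noteq> 0\<close> by force
  have "poly G x = shifted f \<mu> x - shifted f \<mu> y"
    unfolding G_def by (simp add: poly_pcompose x_def y_def shifted_def)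
  then have "vle (poly G x) \<alpha>1" using vle_diff[OF x(2) y] by simp
  moreover have "vle (x ^ e1) (poly G x)"
    unfolding deg[symmetric]
  proof (rule power_degree_vle_poly[OF _ _ x1])
    show "vle 1 (lead_coeff G)" unfolding u(2)
      using C u(1) by (intro absolute_unit_ge absolute_unit_mult absolute_unit_power) simp_all
    show "coeff G i \<in> V" for i
      unfolding G_def
      by (intro coeff_diff_closed coeff_pcompose_closed coeff_f_mem coeff_pCons_closed
          uminus_closed absolute_unit_mem[OF C] zero_closed one_closed) (simp_all add: zero_closed)
  qed
  ultimately have "vle (x ^ e1) x" using \<open>vle \<alpha>1 x\<close> vle_trans by blast
  then show False using vless_power_strict_mono[OF x1, of 1 e1] e1_ge2 by simp
qed

text \<open>A single collision suffices. At a pole of \<open>\<beta>\<close> the parameter has a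
  pole too, and the size of an iterate reveals its index, so both points hit \<open>\<beta>\<close>
  at the same time. But the orbit difference has a unit leading coefficient and cannot vanish at a
  pole.\<close>

lemma algebraic_start_contradiction:
  assumes "C_set f \<alpha>1 \<alpha>2 \<beta> \<noteq> {}" and C: "absolute_unit (poly f \<alpha>1 - poly f \<alpha>2)"
    and alg: "algebraic_over (range of_int) \<alpha>1" "algebraic_over (range of_int) \<alpha>2"
    and \<beta>: "\<not> algebraic_over (range of_int) \<beta>"
  shows False
proof -
  have inv: "\<And>y :: 'k. y \<in> range of_int \<Longrightarrow> inverse y \<in> range of_int"
    using range_of_int_inverse_closed prime_p char by blast
  obtain V where V: "valuation_ring V" "range of_int \<subseteq> V" "\<beta> \<notin> V"
    using exists_valuation_ring[OF unital_subring_range_of_int \<beta>] by blast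
  interpret binomial_valuation p f c1 c2 d1 d2 l1 l2 s1 s2 V
    using V(1) by (rule binomial_valuation_intro)
  have mem: "\<alpha>1 \<in> V" "\<alpha>2 \<in> V" using algebraic_over_imp_mem[OF _ V(2) inv] alg by auto
  obtain \<mu> m n where "0 < m" "0 < n"
      and hits: "(shifted f \<mu> ^^ m) \<alpha>1 = \<beta>" "(shifted f \<mu> ^^ n) \<alpha>2 = \<beta>"
    using assms(1) unfolding C_set_def by blast
  then obtain i j where ij: "m = Suc i" "n = Suc j" using gr0_implies_Suc by metis
  have "\<mu> \<notin> V"
    using poly_closed[OF coeff_orbit_poly_closed[OF coeff_f_mem mem(1)], of \<mu> m] V(3) hits(1)
    by (auto simp: poly_orbit_poly)
  then have \<mu>: "\<not> vle \<mu> 1" by (simp add: vle_one_iff)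
  have size: "vle (\<mu> ^ (d2 ^ k)) ((shifted f \<mu> ^^ Suc k) \<alpha>) \<and> vle ((shifted f \<mu> ^^ Suc k) \<alpha>) (\<mu> ^ (d2 ^ k))"
    if "\<alpha> \<in> V" for \<alpha> k
  proof -
    let ?Q = "orbit_poly f \<alpha> (Suc k)"
    have Q: "coeff ?Q i \<in> V" for i by (intro coeff_orbit_poly_closed coeff_f_mem that)
    obtain \<kappa> where \<kappa>: "absolute_unit \<kappa>" "lead_coeff ?Q = \<kappa>" using orbit_poly_Suc(2) by blast
    have "vle 1 (lead_coeff ?Q)" unfolding \<kappa>(2) by (rule absolute_unit_ge[OF \<kappa>(1)])
    then show ?thesis
      using power_degree_vle_poly[OF Q _ \<mu>] poly_vle_power_degree[OF Q vless_imp_vle[OF \<mu>]]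
      unfolding orbit_poly_Suc poly_orbit_poly by blast
  qed
  have "i = j"
  proof (rule ccontr)
    assume "i \<noteq> j"
    have sizes: "vle (\<mu> ^ (d2 ^ i)) \<beta>" "vle \<beta> (\<mu> ^ (d2 ^ i))" "vle (\<mu> ^ (d2 ^ j)) \<beta>" "vle \<beta> (\<mu> ^ (d2 ^ j))"
      using size[OF mem(1), of i] size[OF mem(2), of j] hits unfolding ij by auto
    consider "d2 ^ i < d2 ^ j" | "d2 ^ j < d2 ^ i"
      using \<open>i \<noteq> j\<close> d2_ge2 by (cases "i < j") (auto intro: power_strict_increasing)
    then show False
      using vless_power_strict_mono[OF \<mu>] sizes vle_trans by cases blast+
  qed
  let ?E = "orbit_diff \<alpha>1 \<alpha>2 (Suc i)"
  have "poly ?E \<mu> = 0"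
    using hits \<open>i = j\<close> unfolding ij orbit_diff_def poly_diff poly_orbit_poly by simp
  moreover have "vle (\<mu> ^ degree ?E) (poly ?E \<mu>)"
  proof (rule power_degree_vle_poly[OF _ _ \<mu>])
    show "vle 1 (lead_coeff ?E)"
      by (rule absolute_unit_ge[OF absolute_unit_lead_coeff_orbit_diff[OF C]])
    show "coeff ?E l \<in> V" for l
      unfolding orbit_diff_def
      by (intro coeff_diff_closed coeff_orbit_poly_closed coeff_f_mem mem)
  qed
  moreover have "\<mu> \<noteq> 0" using \<mu> by auto
  ultimately show False by (simp add: vle_zero_iff)
qed

theorem infinite_collisions_imp_eq:
  assumes inf: "infinite (C_set f \<alpha>1 \<alpha>2 \<beta>)"
    and nonconst: "\<not> (algebraic_over (range of_int) \<alpha>1 \<and> algebraic_over (range of_int) \<alpha>2 \<and>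
      algebraic_over (range of_int) \<beta>)"
  shows "poly f \<alpha>1 = poly f \<alpha>2"
proof (rule ccontr)
  let ?C = "poly f \<alpha>1 - poly f \<alpha>2"
  assume "poly f \<alpha>1 \<noteq> poly f \<alpha>2"
  then have C: "absolute_unit ?C"
    using difference_algebraic[OF inf] prime_p char by (intro algebraic_over_imp_absolute_unit) auto
  \<comment> \<open>Symmetry transfers the argument at a pole of \<open>\<alpha>1\<close> to
    \<open>\<alpha>2\<close>.\<close>
  have "C_set f \<alpha>2 \<alpha>1 \<beta> = C_set f \<alpha>1 \<alpha>2 \<beta>" unfolding C_set_def by blast
  moreover have "absolute_unit (poly f \<alpha>2 - poly f \<alpha>1)" using absolute_unit_minus[OF C] by simp
  ultimately have "algebraic_over (range of_int) \<alpha>1" "algebraic_over (range of_int) \<alpha>2"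
    using transcendental_start_contradiction[of \<alpha>1 \<alpha>2 \<beta>]
      transcendental_start_contradiction[of \<alpha>2 \<alpha>1 \<beta>] inf C by auto
  moreover have "C_set f \<alpha>1 \<alpha>2 \<beta> \<noteq> {}" using inf by auto
  ultimately show False using algebraic_start_contradiction[OF _ C] nonconst by blast
qed

end

section \<open>Existence of infinitely many parameters\<close>

text \<open>A root of multiplicity \<open>r\<close> has multiplicity at least \<open>r - 1\<close>
  in the derivative, in any characteristic. The induction splits off one linear factor and uses the
  product rule.\<close>

lemma dvd_prod_roots_pderiv:
  fixes P :: "'k::alg_closed_field poly"
  assumes "P \<noteq> 0" "finite A" "{a. poly P a = 0} \<subseteq> A"
  shows "P dvd (\<Prod>a\<in>A. [:- a, 1:]) * pderiv P"
  using assms(1,3)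
proof (induction "degree P" arbitrary: P)
  case 0
  then show ?case by (simp add: is_unit_iff_degree unit_imp_dvd)
next
  case (Suc n)
  then obtain a where a: "poly P a = 0" using alg_closed_imp_poly_has_root[of P] by auto
  then obtain Q where P: "P = [:- a, 1:] * Q" by (auto simp: poly_eq_0_iff_dvd elim: dvdE)
  have "Q \<noteq> 0" using Suc.prems P by auto
  then have "degree P = Suc (degree Q)" unfolding P by (subst degree_mult_eq) auto
  let ?R = "\<Prod>a\<in>A. [:- a, 1:]"
  have "{b. poly Q b = 0} \<subseteq> A" using Suc.prems(2) unfolding P by auto
  then have "Q dvd ?R * pderiv Q"
    using Suc.hyps \<open>Q \<noteq> 0\<close> \<open>degree P = Suc (degree Q)\<close> by simp
  then have "P dvd [:- a, 1:] * (?R * pderiv Q)" unfolding P by (rule mult_dvd_mono[OF dvd_refl])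
  moreover have "[:- a, 1:] dvd ?R" using a Suc.prems(2) assms(2) by (intro dvd_prodI) auto
  then have "P dvd ?R * Q" unfolding P by (rule mult_dvd_mono) simp
  moreover have "?R * pderiv P = [:- a, 1:] * (?R * pderiv Q) + ?R * Q"
    unfolding P pderiv_mult by (simp add: pderiv_pCons algebra_simps)
  ultimately show ?case by simp
qed

text \<open>A lower bound for the number of distinct roots, useful when the derivative has
  unexpectedly small degree.\<close>

lemma degree_le_card_roots_pderiv:
  fixes P :: "'k::alg_closed_field poly"
  assumes "pderiv P \<noteq> 0" "finite A" "{a. poly P a = 0} \<subseteq> A"
  shows "degree P \<le> card A + degree (pderiv P)"
proof -
  let ?R = "\<Prod>a\<in>A. [:- a, 1:]"
  have "P dvd ?R * pderiv P" using assms by (intro dvd_prod_roots_pderiv) auto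
  moreover have "?R \<noteq> 0" using assms(2) by (simp add: prod_zero_iff)
  ultimately have "degree P \<le> degree (?R * pderiv P)" using assms(1) by (intro dvd_imp_degree_le) auto
  also have "\<dots> = card A + degree (pderiv P)"
    using \<open>?R \<noteq> 0\<close> assms(1) by (simp add: degree_mult_eq degree_prod_eq_sum_degree)
  finally show ?thesis .
qed

context binomial_family
begin

text \<open>The upper monomial has derivative zero, since \<open>l1 < l2\<close> forces
  \<open>p dvd d2\<close>. The right side is itself zero if \<open>l1 > 0\<close>.\<close>

lemma pderiv_f: "pderiv f = monom (of_nat d1 * c1) (d1 - 1)"
proof -
  have "p dvd d2" using l1_less_l2 d2(1) by (simp add: dvd_power)
  then have "of_nat d2 = (0 :: 'k)" using of_nat_eq_0_iff_char_dvd char by metis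
  then show ?thesis unfolding f_eq by (simp add: pderiv_add pderiv_monom)
qed

text \<open>By the chain rule each step multiplies the derivative by \<open>f'\<close> at the
  previous iterate and adds 1. As \<open>f'\<close> has degree at most \<open>d1 - 1\<close>, the
  degree gap to the orbit polynomial keeps growing.\<close>

lemma pderiv_orbit_poly:
  "pderiv (orbit_poly f \<alpha> (Suc k)) \<noteq> 0 \<and> degree (pderiv (orbit_poly f \<alpha> (Suc k))) + Suc k \<le> d2 ^ k"
proof (induction k)
  case 0
  then show ?case unfolding orbit_poly_one by (simp add: pderiv_pCons)
next
  case (Suc k)
  let ?x = "orbit_poly f \<alpha> (Suc k)"
  define G where "G = pcompose (pderiv f) ?x * pderiv ?x"
  have eq: "pderiv (orbit_poly f \<alpha> (Suc (Suc k))) = G + 1"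
    unfolding orbit_poly.simps(2)[of f \<alpha> "Suc k"] G_def
    by (simp add: pderiv_add pderiv_pcompose pderiv_pCons one_pCons del: orbit_poly.simps)
  have x: "degree ?x = d2 ^ k" by (rule orbit_poly_Suc)
  have comp: "degree (pcompose (pderiv f) ?x) = degree (pderiv f) * d2 ^ k"
    unfolding degree_pcompose x ..
  have pos: "1 \<le> d2 ^ k" using d12 by simp
  have "degree G + Suc k \<le> (d1 - 1) * d2 ^ k + d2 ^ k"
  proof -
    have "degree (pderiv f) \<le> d1 - 1" unfolding pderiv_f by (rule degree_monom_le)
    then have "degree (pcompose (pderiv f) ?x) \<le> (d1 - 1) * d2 ^ k"
      unfolding comp by (rule mult_le_mono1)
    then show ?thesis
      using Suc degree_mult_le[of "pcompose (pderiv f) ?x" "pderiv ?x"] unfolding G_def by linarith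
  qed
  also have "\<dots> = d1 * d2 ^ k" using d12 by (cases d1) auto
  finally have "degree G + Suc k \<le> d1 * d2 ^ k" .
  moreover have "(d1 + 1) * d2 ^ k \<le> d2 * d2 ^ k" using d12 by (intro mult_le_mono1) simp
  then have "d1 * d2 ^ k + d2 ^ k \<le> d2 ^ Suc k" by simp
  ultimately have "degree G + Suc (Suc k) \<le> d2 ^ Suc k" using pos by linarith
  moreover have "degree (G + 1) \<le> degree G" by (rule degree_add_le) auto
  \<comment> \<open>The added 1 could only be cancelled by a constant \<open>G\<close>, which would
    make \<open>f'\<close> a nonzero constant and force \<open>d1 = 1\<close>, against
    \<open>e1 \<ge> 2\<close>.\<close>
  moreover have "G + 1 \<noteq> 0"
  proof
    assume "G + 1 = 0"
    then have "G = - 1" by (simp add: eq_neg_iff_add_eq_0)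
    then have "degree G = 0" "G \<noteq> 0" by auto
    then have "pderiv f \<noteq> 0" "degree (pcompose (pderiv f) ?x) = 0"
      unfolding G_def by (auto simp: degree_mult_eq simp del: orbit_poly.simps)
    then have "degree (pderiv f) = 0" using d12 unfolding comp by simp
    moreover have "degree (pderiv f) = d1 - 1"
      using \<open>pderiv f \<noteq> 0\<close> unfolding pderiv_f by (intro degree_monom_eq) auto
    ultimately show False using e1_add e1_ge2 q_pos(1) by linarith
  qed
  ultimately show ?case unfolding eq by linarith
qed

theorem eq_imp_infinite_collisions:
  assumes eq: "poly f \<alpha>1 = poly f \<alpha>2"
  shows "infinite (C_set f \<alpha>1 \<alpha>2 \<beta>)"
proof
  let ?A = "C_set f \<alpha>1 \<alpha>2 \<beta>"
  assume fin: "finite ?A"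
  \<comment> \<open>The degree gap \<open>Suc k\<close> then yields \<open>k + 1\<close> distinct
    roots of \<open>?P\<close>, and each of them is a collision parameter with both hitting times
    \<open>Suc k\<close>.\<close>
  define k where "k = card ?A"
  let ?x = "orbit_poly f \<alpha>1 (Suc k)"
  let ?P = "?x - [:\<beta>:]"
  have same: "(shifted f \<mu> ^^ Suc k) \<alpha>1 = (shifted f \<mu> ^^ Suc k) \<alpha>2" for k \<mu>
    using eq by (simp add: funpow_swap1 shifted_def[of f \<mu> \<alpha>1] shifted_def[of f \<mu> \<alpha>2])
  have "{\<mu>. poly ?P \<mu> = 0} \<subseteq> ?A"
  proof
    fix \<mu> assume "\<mu> \<in> {\<mu>. poly ?P \<mu> = 0}"
    then have "(shifted f \<mu> ^^ Suc k) \<alpha>1 = \<beta>"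
      by (simp only: mem_Collect_eq poly_diff poly_orbit_poly) simp
    then show "\<mu> \<in> ?A"
      unfolding C_set_def using same[of k \<mu>] by (intro CollectI exI[of _ "Suc k"]) simp
  qed
  moreover have d: "pderiv ?P = pderiv ?x" by (simp add: pderiv_diff del: orbit_poly.simps)
  ultimately have "degree ?P \<le> k + degree (pderiv ?x)"
    using degree_le_card_roots_pderiv[OF _ fin, of ?P] pderiv_orbit_poly[of \<alpha>1 k]
    unfolding d k_def[symmetric] by blast
  moreover have "degree ?P = d2 ^ k"
  proof -
    have "degree (- [:\<beta>:]) < degree ?x" unfolding orbit_poly_Suc(1) using d12 by simp
    then have "degree (?x + - [:\<beta>:]) = degree ?x" by (rule degree_add_eq_left)
    then show ?thesis unfolding diff_conv_add_uminus[symmetric] orbit_poly_Suc(1) .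
  qed
  ultimately show False using pderiv_orbit_poly[of \<alpha>1 k] by linarith
qed

end

theorem theorem1p8:
  fixes p :: nat
    and L :: "'k::alg_closed_field set"
    and f :: "'k poly"
    and c1 c2 \<alpha>1 \<alpha>2 \<beta> :: 'k
    and d1 d2 l1 l2 s1 s2 :: nat
  assumes "prime p"
    and "CHAR('k) = p"
    and "algebraic_closure_of L"
    and "f = monom c1 d1 + monom c2 d2"
    and "c1 \<in> Fp_bar" "c1 \<noteq> 0" "c2 \<in> Fp_bar" "c2 \<noteq> 0"
    and "1 \<le> d1" "d1 < d2"
    and "d1 = p ^ l1 * s1" "\<not> p dvd s1"
    and "d2 = p ^ l2 * s2" "\<not> p dvd s2"
    and "s2 > 1"
    and "p ^ l2 * (s2 - 1) < p ^ l1 * (s1 - 1)"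
    and "\<alpha>1 \<in> L" "\<alpha>2 \<in> L" "\<beta> \<in> L"
    and "\<not> (\<alpha>1 \<in> Fp_bar \<and> \<alpha>2 \<in> Fp_bar \<and> \<beta> \<in> Fp_bar)"
  shows "infinite (C_set f \<alpha>1 \<alpha>2 \<beta>) \<longleftrightarrow> poly f \<alpha>1 = poly f \<alpha>2"
proof -
  have "absolute_unit c1" "absolute_unit c2"
    using assms(1,2,5-8) unfolding Fp_bar_def by (auto intro: algebraic_over_imp_absolute_unit)
  then interpret binomial_family p f c1 c2 d1 d2 l1 l2 s1 s2
    using assms by unfold_locales
  show ?thesis
    using infinite_collisions_imp_eq eq_imp_infinite_collisions assms(20) unfolding Fp_bar_def by blast
qed

end
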